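(* Let $n\ge 1$. The ring of invariants $(P_n\otimes E_n)^{SL_n(\mathbb{F}_q)}$ of the polynomial tensor exterior algebra $P_n\otimes E_n$ with respect to the action of the special linear group $SL_n(\mathbb{F}_q)$ is a free $P_n^{SL_n(\mathbb{F}_q)}$-module with the basis $\{1\}\cup\{Q_I\,dx_1\cdots dx_n : I\in A'_n\}$.
   Context: Let $p$ be an odd prime, $q$ a power of $p$, $\mathbb{F}_q$ the field with $q$ elements. $P_n=\mathbb{F}_q[x_1,\dots,x_n]$; $E_n=\Lambda(dx_1,\dots,dx_n)$ is the exterior algebra over $\mathbb{F}_q$ on $dx_1,\dots,dx_n$, with $E_n^r=\Lambda^r(dx_1,\dots,dx_n)$. $P_n\otimes E_n$ (tensor over $\mathbb{F}_q$) is graded by $\deg x_i=2$, $\deg dx_i=1$. Action: for $g\in GL_n(\mathbb{F}_q)$, $g x_i=\sum_{j} a_{i,j}(g^{-1})x_j$, $g\,dx_i=\sum_j a_{i,j}(g^{-1})dx_j$, $g(xy)=g(x)g(y)$, where $a_{i,j}(g^{-1})$ is the $(i,j)$ entry of $g^{-1}$. Milnor operations: for $j\ge 0$, $Q_j:P_n\otimes E_n^r\to P_n\otimes E_n^{r-1}$ is the $P_n$-linear derivation determined by $Q_j(xy)=(Q_jx)y+(-1)^{\deg x}x(Q_jy)$, $Q_j\,dx_i=x_i^{q^j}$, $Q_jx_i=0$. For $I=\{i_1<\dots<i_r\}$, $Q_I=Q_{i_1}\cdots Q_{i_r}$, and $Q_\emptyset=1$. $A'_n$ denotes the set of proper subsets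 of $\{0,1,\dots,n-1\}$ (i.e. subsets with $r$ elements, $0\le r\le n-1$, including $\emptyset$). *)

theory Defs
  imports "HOL-Analysis.Analysis" "HOL-Library.Poly_Mapping"
begin

section \<open>The exterior algebra of a finitely generated free module\<close>

text \<open>
  \<open>('r, 'n) exterior\<close> is the exterior algebra over the commutative ring \<open>'r\<close> on generators
  \<open>dx i\<close> indexed by the finite linear order \<open>'n\<close>.  An element is given by its coordinates in the
  basis \<open>dx\<^sub>S\<close>, the product of the \<open>dx s\<close> with \<open>s \<in> S\<close> in increasing order.  In the product
  \<open>dx\<^sub>S dx\<^sub>T\<close> of disjoint \<open>S\<close> and \<open>T\<close>, one transposition is needed for every pair
  \<open>(s, t) \<in> S \<times> T\<close> with \<open>t < s\<close>.
\<close>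

datatype ('r, 'n) exterior = Ext (ecoeff: "'n set \<Rightarrow> 'r")

definition inversions :: "'n::linorder set \<Rightarrow> 'n set \<Rightarrow> nat" where
  "inversions S T = card {(s, t). s \<in> S \<and> t \<in> T \<and> t < s}"

lemma exterior_eqI: "(\<And>S. ecoeff f S = ecoeff g S) \<Longrightarrow> f = g"
  by (cases f; cases g) auto

instantiation exterior :: (ab_group_add, type) ab_group_add
begin

definition zero_exterior :: "('a, 'b) exterior" where
  "0 = Ext (\<lambda>S. 0)"

definition plus_exterior :: "('a, 'b) exterior \<Rightarrow> ('a, 'b) exterior \<Rightarrow> ('a, 'b) exterior" where
  "f + g = Ext (\<lambda>S. ecoeff f S + ecoeff g S)"

definition uminus_exterior :: "('a, 'b) exterior \<Rightarrow> ('a, 'b) exterior" where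
  "- f = Ext (\<lambda>S. - ecoeff f S)"

definition minus_exterior :: "('a, 'b) exterior \<Rightarrow> ('a, 'b) exterior \<Rightarrow> ('a, 'b) exterior" where
  "f - g = Ext (\<lambda>S. ecoeff f S - ecoeff g S)"

instance
  by intro_classes
    (auto intro!: exterior_eqI
      simp: zero_exterior_def plus_exterior_def uminus_exterior_def minus_exterior_def ac_simps)

end

lemma ecoeff_zero [simp]: "ecoeff 0 S = 0"
  and ecoeff_add [simp]: "ecoeff (f + g) S = ecoeff f S + ecoeff g S"
  and ecoeff_uminus [simp]: "ecoeff (- f) S = - ecoeff f S"
  and ecoeff_minus [simp]: "ecoeff (f - g) S = ecoeff f S - ecoeff g S"
  by (simp_all add: zero_exterior_def plus_exterior_def uminus_exterior_def minus_exterior_def)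

lemma ecoeff_sum [simp]: "ecoeff (sum f A) S = (\<Sum>a\<in>A. ecoeff (f a) S)"
  by (induction A rule: infinite_finite_induct) auto

lemma inversions_empty [simp]: "inversions {} T = 0" "inversions S {} = 0"
  by (auto simp: inversions_def)

lemma inversions_Un_left:
  fixes S T U :: "'n::{finite,linorder} set"
  assumes "S \<inter> T = {}"
  shows "inversions (S \<union> T) U = inversions S U + inversions T U"
proof -
  have "{(s, t). s \<in> S \<union> T \<and> t \<in> U \<and> t < s} =
      {(s, t). s \<in> S \<and> t \<in> U \<and> t < s} \<union> {(s, t). s \<in> T \<and> t \<in> U \<and> t < s}"
    by auto
  then show ?thesis
    unfolding inversions_def using assms by (subst card_Un_disjoint[symmetric]) auto
qed

lemma inversions_Un_right:
  fixes S T U :: "'n::{finite,linorder} set"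
  assumes "S \<inter> T = {}"
  shows "inversions U (S \<union> T) = inversions U S + inversions U T"
proof -
  have "{(s, t). s \<in> U \<and> t \<in> S \<union> T \<and> t < s} =
      {(s, t). s \<in> U \<and> t \<in> S \<and> t < s} \<union> {(s, t). s \<in> U \<and> t \<in> T \<and> t < s}"
    by auto
  then show ?thesis
    unfolding inversions_def using assms by (subst card_Un_disjoint[symmetric]) auto
qed

instantiation exterior :: (comm_ring_1, "{finite,linorder}") ring_1
begin

definition one_exterior :: "('a, 'b) exterior" where
  "1 = Ext (\<lambda>S. if S = {} then 1 else 0)"

definition times_exterior :: "('a, 'b) exterior \<Rightarrow> ('a, 'b) exterior \<Rightarrow> ('a, 'b) exterior" where
  "f * g = Ext (\<lambda>U. \<Sum>S\<in>Pow U. (- 1) ^ inversions S (U - S) * ecoeff f S * ecoeff g (U - S))"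

instance
proof
  fix f g h :: "('a, 'b) exterior"
  show "f * g * h = f * (g * h)"
  proof (rule exterior_eqI)
    fix U :: "'b set"
    let ?e = "\<lambda>S T. (- 1 :: 'a) ^ inversions S T"
    have "ecoeff (f * g * h) U = (\<Sum>V\<in>Pow U. \<Sum>S\<in>Pow V.
        ?e V (U - V) * (?e S (V - S) * ecoeff f S * ecoeff g (V - S)) * ecoeff h (U - V))"
      by (simp add: times_exterior_def sum_distrib_left sum_distrib_right)
    also have "\<dots> = (\<Sum>(V, S)\<in>Sigma (Pow U) Pow.
        ?e V (U - V) * (?e S (V - S) * ecoeff f S * ecoeff g (V - S)) * ecoeff h (U - V))"
      by (subst sum.Sigma) auto
    also have "\<dots> = (\<Sum>(S, T)\<in>Sigma (Pow U) (\<lambda>S. Pow (U - S)).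
        ?e S (U - S) * ecoeff f S * (?e T (U - S - T) * ecoeff g T * ecoeff h (U - S - T)))"
    proof (rule sum.reindex_bij_witness[where i = "\<lambda>(S, T). (S \<union> T, S)"
            and j = "\<lambda>(V, S). (S, V - S)"])
      fix a assume "a \<in> Sigma (Pow U) Pow"
      then obtain V S where a: "a = (V, S)" and sub: "S \<subseteq> V" "V \<subseteq> U" by auto
      have [simp]: "U - S - (V - S) = U - V" using sub by auto
      have "inversions V (U - V) = inversions S (U - V) + inversions (V - S) (U - V)"
        using inversions_Un_left[of S "V - S" "U - V"] sub by (simp add: Un_absorb1)
      moreover have "(V - S) \<union> (U - V) = U - S" using sub by auto
      then have "inversions S (U - S) = inversions S (V - S) + inversions S (U - V)"
        using inversions_Un_right[of "V - S" "U - V" S] by auto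
      ultimately have "?e V (U - V) * ?e S (V - S) = ?e S (U - S) * ?e (V - S) (U - V)"
        by (simp add: power_add mult_ac)
      then show "(case case a of (V, S) \<Rightarrow> (S, V - S) of (S, T) \<Rightarrow>
            ?e S (U - S) * ecoeff f S * (?e T (U - S - T) * ecoeff g T * ecoeff h (U - S - T))) =
          (case a of (V, S) \<Rightarrow>
            ?e V (U - V) * (?e S (V - S) * ecoeff f S * ecoeff g (V - S)) * ecoeff h (U - V))"
        by (simp add: a mult_ac)
    qed auto
    also have "\<dots> = ecoeff (f * (g * h)) U"
      by (subst sum.Sigma[symmetric]) (auto simp: times_exterior_def sum_distrib_left)
    finally show "ecoeff (f * g * h) U = ecoeff (f * (g * h)) U" .
  qed
  have *: "(\<Sum>S\<in>Pow U. c S * (if S = {} then 1 else 0) * d S) = c {} * d {}"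
    for c d :: "'b set \<Rightarrow> 'a" and U
    by (subst sum.remove[of _ "{}"]) (auto intro!: sum.neutral)
  show "1 * f = f"
    by (rule exterior_eqI) (simp add: times_exterior_def one_exterior_def *)
  show "f * 1 = f"
  proof (rule exterior_eqI)
    fix U :: "'b set"
    have "ecoeff (f * 1) U = (\<Sum>S\<in>Pow U. if S = U then ecoeff f U else 0)"
      unfolding times_exterior_def one_exterior_def exterior.sel
      by (rule sum.cong) auto
    then show "ecoeff (f * 1) U = ecoeff f U" by simp
  qed
  show "(f + g) * h = f * h + g * h" "f * (g + h) = f * g + f * h"
    by (rule exterior_eqI; simp add: times_exterior_def algebra_simps sum.distrib)+
  show "(0 :: ('a, 'b) exterior) \<noteq> 1"
    by (simp add: zero_exterior_def one_exterior_def fun_eq_iff)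
qed

end

text \<open>The scalar multiplication, and the basis element \<open>dx\<^sub>S\<close>.\<close>

definition escale :: "'r::comm_ring_1 \<Rightarrow> ('r, 'n) exterior \<Rightarrow> ('r, 'n) exterior" where
  "escale r f = Ext (\<lambda>S. r * ecoeff f S)"

definition dxs :: "'n set \<Rightarrow> ('r::comm_ring_1, 'n) exterior" where
  "dxs S = Ext (\<lambda>T. if T = S then 1 else 0)"

definition dx :: "'n \<Rightarrow> ('r::comm_ring_1, 'n) exterior" where
  "dx i = dxs {i}"

lemma ecoeff_escale [simp]: "ecoeff (escale r f) S = r * ecoeff f S"
  by (simp add: escale_def)

lemma ecoeff_dxs: "ecoeff (dxs S) T = (if T = S then 1 else 0)"
  by (simp add: dxs_def)

lemma dxs_empty: "dxs {} = 1"
  by (rule exterior_eqI) (simp add: dxs_def one_exterior_def)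

global_interpretation escale: module escale
  by standard (auto intro!: exterior_eqI simp: algebra_simps)

lemma escale_mult_left: "escale r f * g = escale r (f * g)"
  by (rule exterior_eqI) (simp add: times_exterior_def sum_distrib_left mult_ac)

lemma escale_mult_right: "f * escale r g = escale r (f * g)"
  by (rule exterior_eqI) (simp add: times_exterior_def sum_distrib_left mult_ac)

lemma escale_eq_mult: "escale r f = escale r 1 * f"
  by (simp add: escale_mult_left)

lemma exterior_expansion:
  fixes f :: "('r::comm_ring_1, 'n::finite) exterior"
  shows "f = (\<Sum>S\<in>UNIV. escale (ecoeff f S) (dxs S))"
  by (rule exterior_eqI) (simp add: ecoeff_dxs if_distrib cong: if_cong)

lemma dxs_mult:
  "dxs S * dxs T =
     (if S \<inter> T = {} then escale ((- 1) ^ inversions S T) (dxs (S \<union> T)) else 0)"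
proof (rule exterior_eqI)
  fix U
  have "ecoeff (dxs S * dxs T) U = (\<Sum>V\<in>Pow U. if V = S then
      (- 1) ^ inversions S (U - S) * (if U - S = T then 1 else 0) else 0)"
    unfolding times_exterior_def exterior.sel by (rule sum.cong) (auto simp: ecoeff_dxs)
  also have "\<dots> = (if S \<subseteq> U then (- 1) ^ inversions S (U - S) * (if U - S = T then 1 else 0) else 0)"
    by (subst sum.delta) auto
  also have "\<dots> = ecoeff (if S \<inter> T = {} then escale ((- 1) ^ inversions S T) (dxs (S \<union> T)) else 0) U"
  proof (cases "S \<subseteq> U \<and> U - S = T")
    case True
    then have "S \<inter> T = {}" "U = S \<union> T" by auto
    with True show ?thesis by (simp add: ecoeff_dxs)
  next
    case False
    then have "\<not> (S \<inter> T = {} \<and> U = S \<union> T)" by auto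
    with False show ?thesis by (auto simp: ecoeff_dxs)
  qed
  finally show "ecoeff (dxs S * dxs T) U =
    ecoeff (if S \<inter> T = {} then escale ((- 1) ^ inversions S T) (dxs (S \<union> T)) else 0) U" .
qed

definition below :: "'n::{finite,linorder} \<Rightarrow> 'n set \<Rightarrow> nat" where
  "below i T = card {t \<in> T. t < i}"

lemma inversions_singleton: "inversions {i} T = below i T"
proof -
  have "{(s, t). s \<in> {i} \<and> t \<in> T \<and> t < s} = Pair i ` {t \<in> T. t < i}" by auto
  then show ?thesis by (simp add: inversions_def below_def card_image inj_on_def)
qed

lemma dx_mult_dxs:
  "dx i * dxs T = (if i \<in> T then 0 else escale ((- 1) ^ below i T) (dxs (insert i T)))"
  by (simp add: dx_def dxs_mult inversions_singleton)

lemma below_insert: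
  "i \<notin> T \<Longrightarrow> below j (insert i T) = below j T + (if i < j then 1 else 0)"
proof -
  assume "i \<notin> T"
  moreover have "{t \<in> insert i T. t < j} = (if i < j then insert i {t \<in> T. t < j} else {t \<in> T. t < j})"
    by auto
  ultimately show ?thesis by (simp add: below_def)
qed

lemma below_single: "below i {i} = 0"
  by (auto simp: below_def)

lemma below_0: "\<forall>t\<in>T. i < t \<Longrightarrow> below i T = 0"
  by (auto simp: below_def)

lemma dx_mult_dxs_min: "\<forall>t\<in>T. i < t \<Longrightarrow> dx i * dxs T = dxs (insert i T)"
  by (auto simp: dx_mult_dxs below_0)

lemma dx_square: "dx i * dx i = 0"
  by (metis dx_def dx_mult_dxs singletonI)

lemma dx_anticomm: "dx i * dx j = - (dx j * dx i)"
proof (cases i j rule: linorder_cases)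
  case less
  then have "below i {j} = 0" "below j {i} = 1"
    using below_insert[of i "{}" j] by (auto simp: below_def)
  then show ?thesis
    using less by (simp add: dx_def dxs_mult inversions_singleton insert_commute)
next
  case greater
  then have "below j {i} = 0" "below i {j} = 1"
    using below_insert[of j "{}" i] by (auto simp: below_def)
  then show ?thesis
    using greater by (simp add: dx_def dxs_mult inversions_singleton insert_commute)
qed (simp add: dx_square)

definition ordered_prod :: "('n::{finite,linorder} \<Rightarrow> 'm::monoid_mult) \<Rightarrow> 'n set \<Rightarrow> 'm" where
  "ordered_prod y S = prod_list (map y (sorted_list_of_set S))"

lemma ordered_prod_empty [simp]: "ordered_prod y {} = 1"
  by (simp add: ordered_prod_def)

lemma sorted_list_of_set_insert_min:
  fixes T :: "'n::{finite,linorder} set"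
  assumes "\<forall>t\<in>T. i < t"
  shows "sorted_list_of_set (insert i T) = i # sorted_list_of_set T"
proof -
  have "sorted_list_of_set (insert i T) = insort i (sorted_list_of_set T)"
    using assms by (subst sorted_list_of_set.sorted_key_list_of_set_insert) auto
  then show ?thesis
    using assms by (simp add: insort_is_Cons less_imp_le)
qed

lemma ordered_prod_insert_min:
  assumes "\<forall>t\<in>T. i < t"
  shows "ordered_prod y (insert i T) = y i * ordered_prod y T"
  unfolding ordered_prod_def sorted_list_of_set_insert_min[OF assms] by simp

lemma set_min_induct [case_names empty insert]:
  fixes S :: "'n::{finite,linorder} set"
  assumes "P {}" "\<And>i T. \<forall>t\<in>T. i < t \<Longrightarrow> P T \<Longrightarrow> P (insert i T)"
  shows "P S"
  using finite[of S] by (induction S rule: finite_linorder_min_induct) (use assms in auto)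

lemma dxs_eq_ordered_prod: "dxs S = ordered_prod dx S"
  by (induction S rule: set_min_induct)
    (auto simp: dxs_empty ordered_prod_insert_min simp flip: dx_mult_dxs_min)


text \<open>Extending an anticommuting, square-zero family \<open>y\<close> multiplicatively.\<close>

lemma mult_ordered_prod:
  fixes y :: "'n::{finite,linorder} \<Rightarrow> 'm::ring_1"
  assumes sq: "\<And>i. y i * y i = 0" and ac: "\<And>i j. y i * y j = - (y j * y i)"
  shows "y i * ordered_prod y T =
    (if i \<in> T then 0 else (- 1) ^ below i T * ordered_prod y (insert i T))"
proof (induction T rule: set_min_induct)
  case empty
  then show ?case by (simp add: below_def ordered_prod_insert_min)
next
  case (insert b T)
  note min = \<open>\<forall>t\<in>T. b < t\<close>
  then have "b \<notin> T" by auto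
  show ?case
  proof (cases i b rule: linorder_cases)
    case less
    then have *: "\<forall>t\<in>insert b T. i < t" using min by auto
    then have "i \<notin> insert b T" by auto
    then show ?thesis using * by (simp add: below_0 ordered_prod_insert_min)
  next
    case equal
    then show ?thesis
      using min by (simp add: ordered_prod_insert_min sq flip: mult.assoc)
  next
    case greater
    have "y i * ordered_prod y (insert b T) = - (y b * (y i * ordered_prod y T))"
      by (simp add: ordered_prod_insert_min[OF min] ac[of i b] flip: mult.assoc)
    also have "\<dots> = (if i \<in> insert b T then 0
        else (- 1) ^ below i (insert b T) * ordered_prod y (insert i (insert b T)))"
    proof (cases "i \<in> T")
      case True
      then show ?thesis by (simp add: insert.IH)
    next
      case False
      have "\<forall>t\<in>insert i T. b < t" using min greater by auto
      then have "ordered_prod y (insert i (insert b T)) = y b * ordered_prod y (insert i T)"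
        by (simp add: ordered_prod_insert_min insert_commute[of i b])
      moreover have "below i (insert b T) = Suc (below i T)"
        using \<open>b \<notin> T\<close> greater by (simp add: below_insert)
      moreover have "y b * ((- 1) ^ k * z) = (- 1) ^ k * (y b * z)" for k z
        by (cases "even k") auto
      moreover have "i \<noteq> b" using greater by auto
      ultimately show ?thesis using False by (simp add: insert.IH)
    qed
    finally show ?thesis .
  qed
qed

lemma ordered_prod_mult:
  fixes y :: "'n::{finite,linorder} \<Rightarrow> 'm::ring_1"
  assumes sq: "\<And>i. y i * y i = 0" and ac: "\<And>i j. y i * y j = - (y j * y i)"
  shows "ordered_prod y S * ordered_prod y T =
    (if S \<inter> T = {} then (- 1) ^ inversions S T * ordered_prod y (S \<union> T) else 0)"
proof (induction S rule: set_min_induct)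
  case (insert b S)
  note min = \<open>\<forall>t\<in>S. b < t\<close>
  then have "b \<notin> S" by auto
  have com: "y b * ((- 1) ^ k * z) = (- 1) ^ k * (y b * z)" for k z
    by (cases "even k") auto
  have "ordered_prod y (insert b S) * ordered_prod y T = y b * (ordered_prod y S * ordered_prod y T)"
    by (simp add: ordered_prod_insert_min[OF min] mult.assoc)
  also have "\<dots> = (if insert b S \<inter> T = {} then
      (- 1) ^ inversions (insert b S) T * ordered_prod y (insert b S \<union> T) else 0)"
  proof (cases "S \<inter> T = {}")
    case True
    have "inversions (insert b S) T = below b T + inversions S T"
      using inversions_Un_left[of "{b}" S T] \<open>b \<notin> S\<close> by (simp add: inversions_singleton)
    moreover have "{t \<in> S \<union> T. t < b} = {t \<in> T. t < b}" using min by (auto simp: less_imp_not_less)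
    then have "below b (S \<union> T) = below b T" by (simp add: below_def)
    moreover have "y b * ordered_prod y (S \<union> T) =
        (if b \<in> S \<union> T then 0 else (- 1) ^ below b (S \<union> T) * ordered_prod y (insert b (S \<union> T)))"
      by (rule mult_ordered_prod[OF sq ac])
    ultimately show ?thesis
      using True \<open>b \<notin> S\<close>
      by (simp add: insert.IH com) (simp add: add.commute flip: mult.assoc power_add)
  qed (simp add: insert.IH)
  finally show ?case .
qed simp


section \<open>The algebra \<open>P\<^sub>n \<otimes> E\<^sub>n\<close>\<close>

text \<open>
  The variables are indexed by \<open>'n\<close>, so \<open>n = CARD('n)\<close>.  The algebra \<open>P\<^sub>n \<otimes> E\<^sub>n\<close> is the
  exterior algebra over \<open>P\<^sub>n\<close> on the \<open>dx i\<close> (base change of \<open>E\<^sub>n\<close> from the field to \<open>P\<^sub>n\<close>);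
  elements of \<open>P\<^sub>n\<close> have even degree, so there are no further signs.
\<close>

type_synonym ('a, 'n) mpoly = "('n \<Rightarrow>\<^sub>0 nat) \<Rightarrow>\<^sub>0 'a"
type_synonym ('a, 'n) poly_ext = "(('a, 'n) mpoly, 'n) exterior"

definition cst :: "'a::comm_ring_1 \<Rightarrow> ('a, 'n) mpoly" where
  "cst c = Poly_Mapping.single 0 c"

definition var :: "'n \<Rightarrow> ('a::comm_ring_1, 'n) mpoly" where
  "var i = Poly_Mapping.single (Poly_Mapping.single i 1) 1"

definition poly_emb :: "('a::comm_ring_1, 'n::{finite,linorder}) mpoly \<Rightarrow> ('a, 'n) poly_ext" where
  "poly_emb p = escale p 1"

text \<open>Homogeneity for the grading with \<open>deg x\<^sub>i = 2\<close> and \<open>deg dx\<^sub>i = 1\<close>.\<close>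

definition homogeneous :: "nat \<Rightarrow> ('a::comm_ring_1, 'n::finite) poly_ext \<Rightarrow> bool" where
  "homogeneous d f \<longleftrightarrow> (\<forall>S. \<forall>m \<in> Poly_Mapping.keys (ecoeff f S).
     2 * (\<Sum>i\<in>UNIV. Poly_Mapping.lookup m i) + card S = d)"

lemma poly_emb_simps [simp]:
  "poly_emb 0 = 0" "poly_emb 1 = 1"
  "poly_emb (p + q) = poly_emb p + poly_emb q"
  "poly_emb (p * q) = poly_emb p * poly_emb q"
  by (simp_all add: poly_emb_def escale.scale_left_distrib escale_mult_left)

lemma escale_eq_poly_emb_mult: "escale p f = poly_emb p * f"
  by (simp add: poly_emb_def escale_mult_left)

lemma poly_emb_commute: "poly_emb p * f = f * poly_emb p"
  by (simp add: poly_emb_def escale_mult_left escale_mult_right)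

lemma cst_simps [simp]:
  "cst 0 = 0" "cst 1 = 1" "cst (a + b) = cst a + cst b" "cst (a * b) = cst a * cst b"
  by (simp_all add: cst_def single_add mult_single)

lemma poly_mapping_add_induct [case_names single add]:
  assumes "\<And>m c. P (Poly_Mapping.single m c)" "\<And>p q. P p \<Longrightarrow> P q \<Longrightarrow> P (p + q)"
  shows "P p"
proof (induction p rule: update_induct)
  case const
  show ?case using assms(1)[of undefined 0] by simp
next
  case (update f a b)
  have "Poly_Mapping.update a b f = Poly_Mapping.single a b + f"
    using update(1) by (intro poly_mapping_eqI)
      (auto simp: lookup_add lookup_single lookup_update in_keys_iff when_def)
  then show ?case using assms update by simp
qed

definition mpsubst :: "('n::finite \<Rightarrow> ('a::comm_ring_1, 'n) mpoly) \<Rightarrow> ('a, 'n) mpoly \<Rightarrow> ('a, 'n) mpoly"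
  where "mpsubst l p = (\<Sum>m\<in>Poly_Mapping.keys p.
     cst (Poly_Mapping.lookup p m) * (\<Prod>i\<in>UNIV. l i ^ Poly_Mapping.lookup m i))"

lemma mpsubst_single:
  "mpsubst l (Poly_Mapping.single m c) = cst c * (\<Prod>i\<in>UNIV. l i ^ Poly_Mapping.lookup m i)"
  by (cases "c = 0") (simp_all add: mpsubst_def)

lemma mpsubst_add: "mpsubst l (p + q) = mpsubst l p + mpsubst l q"
  unfolding mpsubst_def by (rule setsum_keys_plus_distrib) (simp_all add: algebra_simps)

lemma mpsubst_mult: "mpsubst l (p * q) = mpsubst l p * mpsubst l q"
proof (induction p rule: poly_mapping_add_induct)
  case (single m c)
  show ?case
  proof (induction q rule: poly_mapping_add_induct)
    case (single m' c')
    then show ?case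
      by (simp add: mult_single mpsubst_single lookup_add power_add prod.distrib mult_ac)
  qed (simp add: mpsubst_add algebra_simps)
qed (simp add: mpsubst_add algebra_simps)

lemma mpsubst_cst: "mpsubst l (cst c) = cst c"
  by (subst (1) cst_def) (simp add: mpsubst_single)

lemma mpsubst_one: "mpsubst l 1 = 1"
  by (metis cst_simps(2) mpsubst_cst)

lemma mpsubst_var: "mpsubst l (var i) = l i"
proof -
  have "(\<Prod>j\<in>UNIV. l j ^ Poly_Mapping.lookup (Poly_Mapping.single i 1) j) = (\<Prod>j\<in>UNIV. if j = i then l j else 1)"
    by (rule prod.cong) (auto simp: lookup_single when_def)
  then show ?thesis by (simp add: var_def mpsubst_single)
qed

lemma single_eq_prod_var:
  fixes m :: "'n::finite \<Rightarrow>\<^sub>0 nat"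
  shows "Poly_Mapping.single m c = cst c * (\<Prod>i\<in>UNIV. var i ^ Poly_Mapping.lookup m i)"
proof -
  have pw: "var i ^ k = Poly_Mapping.single (Poly_Mapping.single i k) (1 :: 'a)" for i :: 'n and k
    by (induction k) (simp_all add: var_def mult_single flip: single_add)
  have "(\<Prod>i\<in>A. var i ^ Poly_Mapping.lookup m i) =
      Poly_Mapping.single (\<Sum>i\<in>A. Poly_Mapping.single i (Poly_Mapping.lookup m i)) (1 :: 'a)" for A
    by (induction A rule: infinite_finite_induct) (auto simp: pw mult_single)
  moreover have "(\<Sum>i\<in>UNIV. Poly_Mapping.single i (Poly_Mapping.lookup m i)) = m"
    by (rule poly_mapping_eqI) (simp add: lookup_sum lookup_single when_def)
  ultimately show ?thesis by (simp add: cst_def mult_single)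
qed


section \<open>The action of the general linear group\<close>

text \<open>
  \<open>act g\<close> is the unique algebra endomorphism with the prescribed values on the generators; its
  existence and uniqueness are \<open>ex1_action\<close> below.
\<close>

definition is_action :: "'a::field^'n::{finite,linorder}^'n::{finite,linorder} \<Rightarrow>
    (('a, 'n) poly_ext \<Rightarrow> ('a, 'n) poly_ext) \<Rightarrow> bool" where
  "is_action g \<phi> \<longleftrightarrow>
     (\<forall>f h. \<phi> (f + h) = \<phi> f + \<phi> h) \<and>
     (\<forall>f h. \<phi> (f * h) = \<phi> f * \<phi> h) \<and>
     (\<forall>c. \<phi> (poly_emb (cst c)) = poly_emb (cst c)) \<and>
     (\<forall>i. \<phi> (poly_emb (var i)) =
        (\<Sum>j\<in>UNIV. escale (cst (matrix_inv g $ i $ j)) (poly_emb (var j)))) \<and>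
     (\<forall>i. \<phi> (dx i) = (\<Sum>j\<in>UNIV. escale (cst (matrix_inv g $ i $ j)) (dx j)))"

definition act :: "'a::field^'n::{finite,linorder}^'n::{finite,linorder} \<Rightarrow>
    ('a, 'n) poly_ext \<Rightarrow> ('a, 'n) poly_ext" where
  "act g = (THE \<phi>. is_action g \<phi>)"

definition act_poly :: "'a::field^'n::{finite,linorder}^'n::{finite,linorder} \<Rightarrow> ('a, 'n) mpoly \<Rightarrow> ('a, 'n) mpoly" where
  "act_poly g = mpsubst (\<lambda>i. \<Sum>j\<in>UNIV. cst (matrix_inv g $ i $ j) * var j)"

definition act_dx :: "'a::field^'n::{finite,linorder}^'n::{finite,linorder} \<Rightarrow> 'n \<Rightarrow> ('a, 'n) poly_ext" where
  "act_dx g i = (\<Sum>j\<in>UNIV. escale (cst (matrix_inv g $ i $ j)) (dx j))"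

definition act_formula :: "'a::field^'n::{finite,linorder}^'n::{finite,linorder} \<Rightarrow>
    ('a, 'n) poly_ext \<Rightarrow> ('a, 'n) poly_ext" where
  "act_formula g f = (\<Sum>S\<in>UNIV. escale (act_poly g (ecoeff f S)) (ordered_prod (act_dx g) S))"

lemma linear_comb_dx_anticomm:
  "(\<Sum>i\<in>A. escale (a i) (dx i)) * (\<Sum>j\<in>B. escale (b j) (dx j)) =
   - ((\<Sum>j\<in>B. escale (b j) (dx j)) * (\<Sum>i\<in>A. escale (a i) (dx i)))"
proof -
  have "(\<Sum>i\<in>A. escale (a i) (dx i)) * (\<Sum>j\<in>B. escale (b j) (dx j)) =
    (\<Sum>i\<in>A. \<Sum>j\<in>B. escale (a i * b j) (dx i * dx j))"
    by (simp add: sum_product escale_mult_left escale_mult_right mult.commute)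
  also have "\<dots> = - (\<Sum>j\<in>B. \<Sum>i\<in>A. escale (b j * a i) (dx j * dx i))"
    unfolding sum_negf[symmetric] escale.scale_minus_right[symmetric] dx_anticomm[symmetric]
    by (subst sum.swap) (intro sum.cong refl arg_cong2[of _ _ _ _ escale] mult.commute)
  also have "(\<Sum>j\<in>B. \<Sum>i\<in>A. escale (b j * a i) (dx j * dx i)) =
    (\<Sum>j\<in>B. escale (b j) (dx j)) * (\<Sum>i\<in>A. escale (a i) (dx i))"
    by (simp add: sum_product escale_mult_left escale_mult_right mult.commute)
  finally show ?thesis .
qed

lemma linear_comb_dx_square:
  "(\<Sum>i\<in>A. escale (a i) (dx i)) * (\<Sum>i\<in>A. escale (a i) (dx i)) = 0"
proof (induction A rule: infinite_finite_induct)
  case (insert x A)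
  have *: "escale (a x) (dx x) * (\<Sum>i\<in>A. escale (a i) (dx i)) =
      - ((\<Sum>i\<in>A. escale (a i) (dx i)) * escale (a x) (dx x))"
    using linear_comb_dx_anticomm[of a "{x}" a A] by simp
  have "escale (a x) (dx x) * escale (a x) (dx x) = 0"
    by (simp add: escale_mult_left escale_mult_right dx_square)
  then show ?case using insert * by (simp add: distrib_left distrib_right)
qed auto

lemma act_poly_simps:
  "act_poly g (p + q) = act_poly g p + act_poly g q"
  "act_poly g (p * q) = act_poly g p * act_poly g q"
  "act_poly g (cst c) = cst c" "act_poly g 1 = 1" "act_poly g 0 = 0"
  "act_poly g (var i) = (\<Sum>j\<in>UNIV. cst (matrix_inv g $ i $ j) * var j)"
  by (simp_all add: act_poly_def mpsubst_add mpsubst_mult mpsubst_cst mpsubst_one mpsubst_var)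
    (simp add: mpsubst_def)

lemma act_formula_add: "act_formula g (f + h) = act_formula g f + act_formula g h"
  by (simp add: act_formula_def act_poly_simps escale.scale_left_distrib sum.distrib)

lemma act_formula_sum: "act_formula g (sum F A) = (\<Sum>a\<in>A. act_formula g (F a))"
  by (induction A rule: infinite_finite_induct)
    (simp_all add: act_formula_add, simp_all add: act_formula_def act_poly_simps)

lemma act_formula_escale_dxs:
  "act_formula g (escale p (dxs S)) = escale (act_poly g p) (ordered_prod (act_dx g) S)"
proof -
  have "act_formula g (escale p (dxs S)) =
     (\<Sum>T\<in>UNIV. if T = S then escale (act_poly g p) (ordered_prod (act_dx g) S) else 0)"
    unfolding act_formula_def by (rule sum.cong) (auto simp: ecoeff_dxs act_poly_simps)
  then show ?thesis by simp
qed

lemma minus_one_power_mult_escale: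
  "(- 1) ^ k * (f :: ('r::comm_ring_1, 'n::{finite,linorder}) exterior) = escale ((- 1) ^ k) f"
  by (cases "even k") (auto simp: escale.scale_minus_left)

lemma act_poly_minus_one_power: "act_poly g ((- 1) ^ k) = (- 1) ^ k"
proof -
  have "act_poly g (- 1) + act_poly g 1 = act_poly g (- 1 + 1)"
    by (simp only: act_poly_simps)
  then have "act_poly g (- 1) = - 1"
    by (simp add: act_poly_simps eq_neg_iff_add_eq_0)
  then show ?thesis by (induction k) (simp_all only: power_0 power_Suc act_poly_simps)
qed

lemma ordered_prod_act_dx_mult:
  "ordered_prod (act_dx g) S * ordered_prod (act_dx g) T =
    (if S \<inter> T = {} then (- 1) ^ inversions S T * ordered_prod (act_dx g) (S \<union> T) else 0)"
proof (rule ordered_prod_mult)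
  show "act_dx g i * act_dx g i = 0" for i
    unfolding act_dx_def by (rule linear_comb_dx_square)
  show "act_dx g i * act_dx g j = - (act_dx g j * act_dx g i)" for i j
    unfolding act_dx_def by (rule linear_comb_dx_anticomm)
qed

lemma act_formula_zero: "act_formula g 0 = 0"
  by (simp add: act_formula_def act_poly_simps)

lemma act_formula_mult: "act_formula g (f * h) = act_formula g f * act_formula g h"
proof -
  have base: "act_formula g (escale p (dxs S) * escale r (dxs T)) =
      act_formula g (escale p (dxs S)) * act_formula g (escale r (dxs T))" for p r S T
  proof -
    have "act_formula g (escale p (dxs S) * escale r (dxs T)) =
      (if S \<inter> T = {} then act_formula g (escale (p * r * (- 1) ^ inversions S T) (dxs (S \<union> T))) else act_formula g 0)"
      by (simp add: escale_mult_left escale_mult_right dxs_mult mult.commute[of p r])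
    also have "\<dots> = escale (act_poly g p * act_poly g r)
        (ordered_prod (act_dx g) S * ordered_prod (act_dx g) T)"
      by (simp add: ordered_prod_act_dx_mult act_formula_escale_dxs act_poly_simps act_poly_minus_one_power
          minus_one_power_mult_escale act_formula_zero)
    finally show ?thesis
      by (simp add: act_formula_escale_dxs escale_mult_left escale_mult_right mult.commute)
  qed
  have "act_formula g ((\<Sum>S\<in>UNIV. escale (ecoeff f S) (dxs S)) * (\<Sum>S\<in>UNIV. escale (ecoeff h S) (dxs S))) =
      act_formula g (\<Sum>S\<in>UNIV. escale (ecoeff f S) (dxs S)) *
      act_formula g (\<Sum>S\<in>UNIV. escale (ecoeff h S) (dxs S))"
    by (simp only: sum_product act_formula_sum base)
  then show ?thesis by (simp only: exterior_expansion[symmetric])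
qed

lemma is_action_act_formula: "is_action g (act_formula g)"
proof -
  have emb: "act_formula g (poly_emb p) = poly_emb (act_poly g p)" for p
    using act_formula_escale_dxs[of g p "{}"] by (simp add: poly_emb_def dxs_empty)
  have "poly_emb (\<Sum>j\<in>A. F j) = (\<Sum>j\<in>A. poly_emb (F j))"
    for F :: "'b \<Rightarrow> ('a, 'b) mpoly" and A
    by (induction A rule: infinite_finite_induct) simp_all
  moreover have "act_formula g (dx i) = act_dx g i" for i
    using act_formula_escale_dxs[of g 1 "{i}"]
    by (simp add: dx_def act_poly_simps ordered_prod_def)
  ultimately show ?thesis
    unfolding is_action_def
    by (simp add: act_formula_add act_formula_mult emb act_poly_simps escale_eq_poly_emb_mult act_dx_def)
qed

lemma is_action_unique:
  assumes \<phi>: "is_action g \<phi>" and \<psi>: "is_action g \<psi>"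
  shows "\<phi> = \<psi>"
proof
  have add: "\<phi> (a + b) = \<phi> a + \<phi> b" "\<psi> (a + b) = \<psi> a + \<psi> b"
    and mult: "\<phi> (a * b) = \<phi> a * \<phi> b" "\<psi> (a * b) = \<psi> a * \<psi> b" for a b
    using \<phi> \<psi> unfolding is_action_def by auto
  have cst: "\<phi> (poly_emb (cst c)) = \<psi> (poly_emb (cst c))"
    and var: "\<phi> (poly_emb (var i)) = \<psi> (poly_emb (var i))" and dx: "\<phi> (dx i) = \<psi> (dx i)" for c i
    using \<phi> \<psi> unfolding is_action_def by auto
  have one: "\<phi> 1 = \<psi> 1" using cst[of 1] by simp
  have pow: "\<phi> (poly_emb (var i ^ k)) = \<psi> (poly_emb (var i ^ k))" for i k
    by (induction k) (simp_all add: one mult var)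
  have "\<phi> (poly_emb (\<Prod>i\<in>A. var i ^ k i)) = \<psi> (poly_emb (\<Prod>i\<in>A. var i ^ k i))" for A k
    by (induction A rule: infinite_finite_induct) (simp_all add: one mult pow)
  then have poly: "\<phi> (poly_emb p) = \<psi> (poly_emb p)" for p
    by (induction p rule: poly_mapping_add_induct) (simp_all add: single_eq_prod_var add mult cst)
  have dxs: "\<phi> (dxs S) = \<psi> (dxs S)" for S
    by (induction S rule: set_min_induct)
      (simp_all add: dxs_empty one mult dx flip: dx_mult_dxs_min)
  have "\<phi> 0 = \<psi> 0" using poly[of 0] by simp
  then have sum: "(\<And>S. S \<in> A \<Longrightarrow> \<phi> (F S) = \<psi> (F S)) \<Longrightarrow> \<phi> (sum F A) = \<psi> (sum F A)"
    for F :: "'b set \<Rightarrow> _" and A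
    by (induction A rule: infinite_finite_induct) (simp_all add: add)
  fix f
  show "\<phi> f = \<psi> f"
    by (subst (1 2) exterior_expansion[of f])
      (rule sum, simp add: escale_eq_poly_emb_mult mult poly dxs)
qed

lemma ex1_action: "\<exists>!\<phi>. is_action g \<phi>"
  using is_action_act_formula is_action_unique by blast

lemma is_action_act: "is_action g (act g)"
  unfolding act_def using ex1_action by (rule theI')

lemma act_eq_act_formula: "act g f = act_formula g f"
  by (rule fun_cong[OF is_action_unique[OF is_action_act is_action_act_formula]])

definition SL :: "('a::field^'n::finite^'n::finite) set" where
  "SL = {g. det g = 1}"

text \<open>Below, \<open>P\<^sub>n\<close> is acted upon as a subalgebra of \<open>P\<^sub>n \<otimes> E\<^sub>n\<close>.\<close>

definition invariants :: "('a::field^'n::{finite,linorder}^'n::{finite,linorder}) set \<Rightarrow>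
    ('a, 'n) poly_ext set" where
  "invariants G = {f. \<forall>g\<in>G. act g f = f}"

definition poly_invariants :: "('a::field^'n::{finite,linorder}^'n::{finite,linorder}) set \<Rightarrow>
    ('a, 'n) mpoly set" where
  "poly_invariants G = {p. \<forall>g\<in>G. act g (poly_emb p) = poly_emb p}"


section \<open>Milnor operations\<close>

text \<open>
  \<open>milnor j\<close> is the unique \<open>P\<^sub>n\<close>-linear derivation \<open>Q\<^sub>j\<close> with the prescribed values on the
  generators; its existence and uniqueness are \<open>ex1_milnor\<close> below.  Here \<open>q = CARD('a)\<close>.
\<close>

definition is_milnor :: "nat \<Rightarrow>
    (('a::{field,finite}, 'n::{finite,linorder}) poly_ext \<Rightarrow> ('a, 'n) poly_ext) \<Rightarrow> bool" where
  "is_milnor j D \<longleftrightarrow>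
     (\<forall>f h. D (f + h) = D f + D h) \<and>
     (\<forall>p f. D (escale p f) = escale p (D f)) \<and>
     (\<forall>d f h. homogeneous d f \<longrightarrow> D (f * h) = D f * h + (- 1) ^ d * f * D h) \<and>
     (\<forall>i. D (dx i) = poly_emb (var i ^ (CARD('a) ^ j))) \<and>
     (\<forall>i. D (poly_emb (var i)) = 0)"

definition milnor :: "nat \<Rightarrow>
    ('a::{field,finite}, 'n::{finite,linorder}) poly_ext \<Rightarrow> ('a, 'n) poly_ext" where
  "milnor j = (THE D. is_milnor j D)"

definition contraction :: "('n \<Rightarrow> 'r::comm_ring_1) \<Rightarrow>
    ('r, 'n::{finite,linorder}) exterior \<Rightarrow> ('r, 'n) exterior" where
  "contraction w f = (\<Sum>S\<in>UNIV. escale (ecoeff f S)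
     (\<Sum>s\<in>S. escale ((- 1) ^ below s S * w s) (dxs (S - {s}))))"

lemma contraction_add: "contraction w (f + h) = contraction w f + contraction w h"
  by (simp add: contraction_def escale.scale_left_distrib sum.distrib)

lemma contraction_escale: "contraction w (escale p f) = escale p (contraction w f)"
  by (simp add: contraction_def escale.scale_sum_right mult.assoc)

lemma contraction_zero: "contraction w 0 = 0"
  by (simp add: contraction_def)

lemma contraction_sum: "contraction w (sum F A) = (\<Sum>a\<in>A. contraction w (F a))"
  by (induction A rule: infinite_finite_induct) (simp_all add: contraction_add contraction_zero)

lemma contraction_dxs:
  "contraction w (dxs S) = (\<Sum>s\<in>S. escale ((- 1) ^ below s S * w s) (dxs (S - {s})))"
proof -
  have "contraction w (dxs S) = (\<Sum>T\<in>UNIV. if T = S then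
      (\<Sum>s\<in>S. escale ((- 1) ^ below s S * w s) (dxs (S - {s}))) else 0)"
    unfolding contraction_def by (rule sum.cong) (auto simp: ecoeff_dxs)
  then show ?thesis by simp
qed

lemma contraction_dx_mult: "contraction w (dx i * f) = escale (w i) f - dx i * contraction w f"
proof -
  have base: "contraction w (dx i * dxs T) = escale (w i) (dxs T) - dx i * contraction w (dxs T)" for T
  proof (cases "i \<in> T")
    case True
    have "dx i * contraction w (dxs T) =
        (\<Sum>s\<in>T. escale ((- 1) ^ below s T * w s) (dx i * dxs (T - {s})))"
      by (simp add: contraction_dxs sum_distrib_left escale_mult_right)
    also have "\<dots> = (\<Sum>s\<in>T. if s = i then escale (w i) (dxs T) else 0)"
    proof (rule sum.cong)
      fix s assume "s \<in> T"
      have "below i (T - {i}) = below i T"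
        unfolding below_def by (rule arg_cong[of _ _ card]) auto
      moreover have "(- 1) ^ k * w i * (- 1) ^ k = w i" for k
        by (cases "even k") auto
      ultimately show "escale ((- 1) ^ below s T * w s) (dx i * dxs (T - {s})) =
          (if s = i then escale (w i) (dxs T) else 0)"
        using True by (auto simp: dx_mult_dxs insert_absorb)
    qed simp
    finally show ?thesis using True by (simp add: dx_mult_dxs contraction_zero)
  next
    case False
    have "contraction w (dx i * dxs T) = (\<Sum>s\<in>insert i T.
        escale ((- 1) ^ below i T * ((- 1) ^ below s (insert i T) * w s)) (dxs (insert i T - {s})))"
      using False by (simp add: dx_mult_dxs contraction_escale contraction_dxs escale.scale_sum_right
        escale.scale_right_distrib)
    also have "\<dots> = escale ((- 1) ^ below i T * ((- 1) ^ below i (insert i T) * w i)) (dxs T) +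
        (\<Sum>s\<in>T. escale ((- 1) ^ below i T * ((- 1) ^ below s (insert i T) * w s)) (dxs (insert i T - {s})))"
      using False by (simp add: insert_Diff_if)
    also have "(- 1) ^ below i T * ((- 1) ^ below i (insert i T) * w i) = w i"
      using False by (cases "even (below i T)") (auto simp: below_insert)
    also have "(\<Sum>s\<in>T. escale ((- 1) ^ below i T * ((- 1) ^ below s (insert i T) * w s)) (dxs (insert i T - {s}))) =
        (\<Sum>s\<in>T. - escale ((- 1) ^ below s T * w s) (dx i * dxs (T - {s})))"
    proof (rule sum.cong)
      fix s assume s: "s \<in> T"
      then have "s \<noteq> i" using False by auto
      have "below i T = below i (T - {s}) + (if s < i then 1 else 0)"
        using below_insert[of s "T - {s}" i] s by (simp add: insert_absorb)
      then have "below i T + below s (insert i T) = Suc (below s T + below i (T - {s}))"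
        using \<open>s \<noteq> i\<close> below_insert[OF False, of s] by auto
      then have "(- 1) ^ (below i T + below s (insert i T)) * w s =
          (- 1) ^ Suc (below s T + below i (T - {s})) * w s"
        by (simp only:)
      then have "(- 1) ^ below i T * ((- 1) ^ below s (insert i T) * w s) =
          - ((- 1) ^ below s T * w s * (- 1) ^ below i (T - {s}))"
        by (simp add: power_add mult_ac)
      moreover have "insert i T - {s} = insert i (T - {s})" using \<open>s \<noteq> i\<close> by auto
      ultimately show "escale ((- 1) ^ below i T * ((- 1) ^ below s (insert i T) * w s)) (dxs (insert i T - {s})) =
          - escale ((- 1) ^ below s T * w s) (dx i * dxs (T - {s}))"
        using False by (simp add: dx_mult_dxs escale.scale_minus_left)
    qed simp
    finally show ?thesis
      by (simp add: contraction_dxs sum_distrib_left escale_mult_right sum_negf)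
  qed
  have "contraction w (dx i * f) =
      (\<Sum>S\<in>UNIV. escale (ecoeff f S) (contraction w (dx i * dxs S)))"
    by (subst exterior_expansion[of f])
      (simp add: sum_distrib_left contraction_sum contraction_escale escale_mult_right)
  also have "\<dots> = escale (w i) (\<Sum>S\<in>UNIV. escale (ecoeff f S) (dxs S)) -
      dx i * contraction w (\<Sum>S\<in>UNIV. escale (ecoeff f S) (dxs S))"
    by (simp add: base sum_distrib_left contraction_sum contraction_escale escale_mult_right
        escale.scale_right_diff_distrib sum_subtractf escale.scale_sum_right mult.commute)
  finally show ?thesis by (simp only: exterior_expansion[symmetric])
qed

lemma contraction_dxs_mult:
  "contraction w (dxs S * f) = contraction w (dxs S) * f + (- 1) ^ card S * dxs S * contraction w f"
proof (induction S rule: set_min_induct)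
  case empty
  show ?case by (simp add: contraction_dxs) (simp add: dxs_empty)
next
  case (insert i S)
  then have "i \<notin> S" by auto
  have com: "dx i * ((- 1) ^ k * z) = (- 1) ^ k * (dx i * z)" for k and z :: "('a, 'b) exterior"
    by (cases "even k") auto
  have "contraction w (dxs (insert i S) * f) = contraction w (dx i * (dxs S * f))"
    by (simp add: mult.assoc flip: dx_mult_dxs_min[OF insert(1)])
  also have "\<dots> = escale (w i) (dxs S * f) - dx i * (contraction w (dxs S) * f) -
      (- 1) ^ card S * (dx i * dxs S * contraction w f)"
    by (simp add: contraction_dx_mult insert(2) distrib_left mult.assoc com)
  also have "\<dots> = contraction w (dx i * dxs S) * f + (- 1) ^ card (insert i S) * (dx i * dxs S) * contraction w f"
    using \<open>i \<notin> S\<close> by (simp add: contraction_dx_mult left_diff_distrib escale_mult_left mult.assoc)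
  finally show ?case by (simp add: dx_mult_dxs_min[OF insert(1)])
qed

lemma even_iff_minus_one_power:
  "even a = even b \<Longrightarrow> (- 1 :: 'a::ring_1) ^ a = (- 1) ^ b"
  by (cases "even a") auto

lemma contraction_mult:
  fixes f h :: "('a::comm_ring_1, 'b::{finite,linorder}) poly_ext"
  assumes "homogeneous d f"
  shows "contraction w (f * h) = contraction w f * h + (- 1) ^ d * f * contraction w h"
proof -
  have *: "contraction w (escale (ecoeff f S) (dxs S) * h) =
      contraction w (escale (ecoeff f S) (dxs S)) * h +
      (- 1) ^ d * escale (ecoeff f S) (dxs S) * contraction w h" for S
  proof (cases "ecoeff f S = 0")
    case False
    then obtain m where "m \<in> Poly_Mapping.keys (ecoeff f S)" by fastforce
    then have "2 * (\<Sum>i\<in>UNIV. Poly_Mapping.lookup m i) + card S = d"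
      using assms by (auto simp: homogeneous_def)
    then have "even (card S) = even d" by auto
    then have "(- 1 :: ('a, 'b) mpoly) ^ card S = (- 1) ^ d"
      by (rule even_iff_minus_one_power)
    then show ?thesis
      by (simp add: escale_mult_left escale_mult_right contraction_escale contraction_dxs_mult
          escale.scale_right_distrib minus_one_power_mult_escale)
  qed (simp add: contraction_zero)
  have "contraction w ((\<Sum>S\<in>UNIV. escale (ecoeff f S) (dxs S)) * h) =
      contraction w (\<Sum>S\<in>UNIV. escale (ecoeff f S) (dxs S)) * h +
      (- 1) ^ d * (\<Sum>S\<in>UNIV. escale (ecoeff f S) (dxs S)) * contraction w h"
    by (simp add: sum_distrib_right sum_distrib_left contraction_sum * sum.distrib)
  then show ?thesis by (simp only: exterior_expansion[symmetric])
qed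

lemma is_milnor_contraction:
  "is_milnor j (contraction (\<lambda>i. var i ^ (CARD('a) ^ j)) ::
     ('a::{field,finite}, 'n::{finite,linorder}) poly_ext \<Rightarrow> _)"
  unfolding is_milnor_def
proof (intro conjI allI impI contraction_add contraction_escale contraction_mult)
  fix i :: 'n
  show "contraction (\<lambda>i. var i ^ (CARD('a) ^ j)) (dx i) = poly_emb (var i ^ (CARD('a) ^ j))"
    by (simp add: dx_def contraction_dxs dxs_empty poly_emb_def) (simp add: below_single)
  show "contraction (\<lambda>i. var i ^ (CARD('a) ^ j)) (poly_emb (var i)) = 0"
    by (simp add: poly_emb_def contraction_escale contraction_dxs flip: dxs_empty)
qed

lemma homogeneous_dx: "homogeneous 1 (dx i)"
  by (auto simp: homogeneous_def dx_def ecoeff_dxs split: if_splits)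

lemma homogeneous_one: "homogeneous 0 1"
  by (auto simp: homogeneous_def ecoeff_dxs simp flip: dxs_empty split: if_splits)

lemma is_milnor_unique:
  fixes D D' :: "('a::{field,finite}, 'b::{finite,linorder}) poly_ext \<Rightarrow> ('a, 'b) poly_ext"
  assumes D: "is_milnor j D" and D': "is_milnor j D'"
  shows "D = D'"
proof
  have add: "D (a + b) = D a + D b" "D' (a + b) = D' a + D' b"
    and sc: "D (escale p a) = escale p (D a)" "D' (escale p a) = escale p (D' a)"
    and dx: "D (dx i) = D' (dx i)" for a b p i
    using D D' unfolding is_milnor_def by auto
  have der: "homogeneous d a \<Longrightarrow> D (a * b) = D a * b + (- 1) ^ d * a * D b"
    "homogeneous d a \<Longrightarrow> D' (a * b) = D' a * b + (- 1) ^ d * a * D' b" for d a b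
    using D D' unfolding is_milnor_def by blast+
  have one: "D 1 = 0" "D' 1 = 0"
    using der[OF homogeneous_one, of 1] by simp_all
  have dxs: "D (dxs S) = D' (dxs S)" for S
    by (induction S rule: set_min_induct)
      (simp_all add: dxs_empty one der[OF homogeneous_dx] dx flip: dx_mult_dxs_min)
  have "D 0 = D' 0" using sc[of 0 0] by simp
  then have sum: "(\<And>S. S \<in> A \<Longrightarrow> D (F S) = D' (F S)) \<Longrightarrow> D (sum F A) = D' (sum F A)"
    for F :: "'b set \<Rightarrow> _" and A
    by (induction A rule: infinite_finite_induct) (simp_all add: add)
  fix f
  have "D (\<Sum>S\<in>UNIV. escale (ecoeff f S) (dxs S)) = D' (\<Sum>S\<in>UNIV. escale (ecoeff f S) (dxs S))"
    by (rule sum) (simp add: sc dxs)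
  then show "D f = D' f" by (simp only: exterior_expansion[symmetric])
qed

lemma ex1_milnor: "\<exists>!D. is_milnor j D"
  using is_milnor_contraction is_milnor_unique by blast

lemma is_milnor_milnor: "is_milnor j (milnor j)"
  unfolding milnor_def using ex1_milnor by (rule theI')

lemma milnor_eq_contraction:
  "milnor j (f :: ('a::{field,finite}, 'n::{finite,linorder}) poly_ext) =
     contraction (\<lambda>i. var i ^ (CARD('a) ^ j)) f"
  by (rule fun_cong[OF is_milnor_unique[OF is_milnor_milnor is_milnor_contraction]])

text \<open>For \<open>I = {i\<^sub>1 < \<dots> < i\<^sub>r}\<close>, this is \<open>Q\<^sub>I = Q\<^bsub>i\<^sub>1\<^esub> \<circ> \<dots> \<circ> Q\<^bsub>i\<^sub>r\<^esub>\<close>.\<close>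

definition milnor_set :: "nat set \<Rightarrow>
    ('a::{field,finite}, 'n::{finite,linorder}) poly_ext \<Rightarrow> ('a, 'n) poly_ext" where
  "milnor_set I = foldr milnor (sorted_list_of_set I)"

definition dx_top :: "('a::field, 'n::{finite,linorder}) poly_ext" where
  "dx_top = ordered_prod dx UNIV"


section \<open>Free modules over a subring\<close>

text \<open>
  \<open>M\<close> is a free module over the subring \<open>R\<close> with basis \<open>B\<close>, where \<open>smul\<close> is the scalar
  multiplication of an ambient module over the ambient ring of \<open>R\<close>.
\<close>

definition is_subring :: "'r::comm_ring_1 set \<Rightarrow> bool" where
  "is_subring R \<longleftrightarrow> 1 \<in> R \<and> (\<forall>a\<in>R. \<forall>b\<in>R. a - b \<in> R \<and> a * b \<in> R)"

definition is_submodule_over ::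
    "('r::comm_ring_1 \<Rightarrow> 'm::ab_group_add \<Rightarrow> 'm) \<Rightarrow> 'r set \<Rightarrow> 'm set \<Rightarrow> bool" where
  "is_submodule_over smul R M \<longleftrightarrow>
     0 \<in> M \<and> (\<forall>u\<in>M. \<forall>v\<in>M. u + v \<in> M) \<and> (\<forall>r\<in>R. \<forall>u\<in>M. smul r u \<in> M)"

definition free_module_with_basis ::
    "('r::comm_ring_1 \<Rightarrow> 'm::ab_group_add \<Rightarrow> 'm) \<Rightarrow> 'r set \<Rightarrow> 'm set \<Rightarrow> 'm set \<Rightarrow> bool" where
  "free_module_with_basis smul R M B \<longleftrightarrow>
     module smul \<and> is_subring R \<and> is_submodule_over smul R M \<and> B \<subseteq> M \<and>
     (\<forall>u\<in>M. \<exists>F c. finite F \<and> F \<subseteq> B \<and> c ` F \<subseteq> R \<and> u = (\<Sum>b\<in>F. smul (c b) b)) \<and>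
     (\<forall>F c. finite F \<and> F \<subseteq> B \<and> c ` F \<subseteq> R \<and> (\<Sum>b\<in>F. smul (c b) b) = 0 \<longrightarrow> (\<forall>b\<in>F. c b = 0))"

end

theory Submission
  imports Defs
begin

text \<open>
  \<open>Q\<^sub>j\<close> is the contraction with the vector \<open>w\<^sub>j = (x\<^sub>i\<^bsup>q^j\<^esup>)\<^sub>i\<close>.  Contractions anticommute and square to
  zero, so \<open>Q\<^sub>J Q\<^sub>I dx\<^sub>1 \<dots> dx\<^sub>n\<close> with \<open>|I| + |J| = n\<close> is \<open>\<plusminus>L\<close> if \<open>J\<close> is the complement of \<open>I\<close> and
  \<open>0\<close> otherwise, where \<open>L\<close> is the determinant of \<open>w\<^sub>0, \<dots>, w\<^sub>n\<^sub>-\<^sub>1\<close> (the Moore determinant).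
  As \<open>L \<noteq> 0\<close>, Cramer's rule shows that a form \<open>f\<close> is determined by the degree-\<open>0\<close> parts of all
  \<open>Q\<^sub>J f\<close>, and the coefficient of \<open>Q\<^sub>I dx\<^sub>1 \<dots> dx\<^sub>n\<close> in \<open>f\<close> has to be \<open>\<plusminus>Q\<^sub>J f / L\<close> for the complement
  \<open>J\<close> of \<open>I\<close>.

  For invariant \<open>f\<close> and \<open>J \<noteq> \<emptyset>\<close> this quotient is a polynomial.  Up to a scalar, \<open>L\<close> is the product of
  the linear forms \<open>l\<close> with last nonzero coefficient \<open>1\<close>, so it suffices that every such \<open>l\<close> divides
  \<open>Q\<^sub>j h\<close> for an invariant \<open>h\<close> with \<open>1\<close>-form part \<open>\<Sum> h\<^sub>i dx\<^sub>i\<close>.  Comparing coefficients in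
  \<open>g h = h\<close> for the transvections \<open>g\<close> along \<open>l = \<Sum> v\<^sub>i x\<^sub>i\<close> shows that \<open>(h\<^sub>i)\<close> is modulo \<open>l\<close> a
  multiple of \<open>(v\<^sub>i)\<close>, whence \<open>Q\<^sub>j h = \<Sum> h\<^sub>i x\<^sub>i\<^bsup>q^j\<^esup>\<close> is modulo \<open>l\<close> a multiple of
  \<open>\<Sum> v\<^sub>i x\<^sub>i\<^bsup>q^j\<^esup> = l\<^bsup>q^j\<^esup>\<close>.
\<close>


section \<open>Iterated contractions of exterior forms\<close>

text \<open>Every \<open>dxs S\<close> arises from \<open>1\<close> by multiplying on the left with
  ever smaller generators. This reduces identities between additive, scalar-compatible maps to their
  Leibniz rule at a single \<open>dx i\<close>.\<close>

lemma exterior_induct [case_names one add escale dx_mult]: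
  fixes f :: "('r::comm_ring_1, 'n::{finite,linorder}) exterior"
  assumes one: "P 1" and add: "\<And>f g. P f \<Longrightarrow> P g \<Longrightarrow> P (f + g)"
    and escale: "\<And>r f. P f \<Longrightarrow> P (escale r f)" and dx: "\<And>i f. P f \<Longrightarrow> P (dx i * f)"
  shows "P f"
proof -
  have dxs: "P (dxs S)" for S
    by (induction S rule: set_min_induct) (auto simp: dxs_empty one dx simp flip: dx_mult_dxs_min)
  have "P (escale 0 1)" by (intro escale one)
  then have "P 0" by simp
  then have "P (\<Sum>S\<in>A. escale (ecoeff f S) (dxs S))" for A
    by (induction A rule: infinite_finite_induct) (auto intro: add escale dxs)
  then show ?thesis by (subst exterior_expansion) blast
qed

lemma minus_one_power_twice: "(- 1) ^ k * (- 1 :: 'a::ring_1) ^ k = 1"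
  by (cases "even k") auto

lemma ecoeff_one: "ecoeff 1 S = (if S = {} then 1 else 0)"
  by (simp add: ecoeff_dxs flip: dxs_empty)

lemma ecoeff_dx_mult_empty: "ecoeff (dx i * f) {} = 0"
  by (simp add: times_exterior_def dx_def ecoeff_dxs)

lemma ecoeff_dx_mult_singleton: "ecoeff (dx i * f) {k} = (if i = k then ecoeff f {} else 0)"
proof -
  have "Pow {k} = {{}, {k}}" by auto
  then show ?thesis by (auto simp: times_exterior_def dx_def ecoeff_dxs)
qed

lemma contraction_one: "contraction w 1 = 0"
  by (simp add: contraction_dxs flip: dxs_empty)

lemma contraction_uminus: "contraction w (- f) = - contraction w f"
  using contraction_escale[of w "- 1" f] by (simp add: escale.scale_minus_left)

lemma contraction_diff: "contraction w (f - g) = contraction w f - contraction w g"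
  using contraction_add[of w f "- g"] by (simp add: contraction_uminus)

lemma contraction_anticomm: "contraction w (contraction v f) = - contraction v (contraction w f)"
  by (induction f rule: exterior_induct)
    (simp_all add: contraction_one contraction_zero contraction_add contraction_escale
      contraction_dx_mult contraction_diff escale.scale_minus_right)

text \<open>Anticommutation only gives that twice this form vanishes, so over a general commutative
  ring a separate induction is made.\<close>

lemma contraction_twice: "contraction w (contraction w f) = 0"
  by (induction f rule: exterior_induct)
    (simp_all add: contraction_one contraction_zero contraction_add contraction_escale
      contraction_dx_mult contraction_diff)

lemma ecoeff_contraction:
  "ecoeff (contraction w f) T = (\<Sum>s\<in>- T. (- 1) ^ below s T * w s * ecoeff f (insert s T))"
proof -
  have "ecoeff (contraction w f) T = (\<Sum>S\<in>UNIV. \<Sum>s\<in>S.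
      ecoeff f S * ((- 1) ^ below s S * w s * (if T = S - {s} then 1 else 0)))"
    by (simp add: contraction_def ecoeff_dxs sum_distrib_left cong: if_cong)
  also have "\<dots> = (\<Sum>(S, s)\<in>Sigma UNIV (\<lambda>S. S).
      ecoeff f S * ((- 1) ^ below s S * w s * (if T = S - {s} then 1 else 0)))"
    by (subst sum.Sigma) auto
  \<comment> \<open>Removing \<open>s\<close> from \<open>S\<close> yields \<open>T\<close> exactly
    when \<open>s\<close> lies outside \<open>T\<close> and \<open>S = insert s T\<close>.\<close>
  also have "\<dots> = (\<Sum>(S, s)\<in>(\<lambda>s. (insert s T, s)) ` (- T).
      ecoeff f S * ((- 1) ^ below s S * w s * (if T = S - {s} then 1 else 0)))"
    by (rule sum.mono_neutral_right) (auto simp: image_iff)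
  also have "\<dots> = (\<Sum>s\<in>- T. (- 1) ^ below s T * w s * ecoeff f (insert s T))"
    by (subst sum.reindex) (auto simp: inj_on_def below_insert mult_ac intro!: sum.cong)
  finally show ?thesis .
qed

section \<open>Iterated contractions along lists and sets of indices\<close>

definition contractions ::
    "(nat \<Rightarrow> 'n \<Rightarrow> 'r::comm_ring_1) \<Rightarrow> nat list \<Rightarrow> ('r, 'n::{finite,linorder}) exterior \<Rightarrow> ('r, 'n) exterior" where
  "contractions w js = foldr (\<lambda>j. contraction (w j)) js"

lemma contractions_simps [simp]:
  "contractions w [] f = f"
  "contractions w (j # js) f = contraction (w j) (contractions w js f)"
  "contractions w (is @ js) f = contractions w is (contractions w js f)"
  by (simp_all add: contractions_def)

lemma contractions_add: "contractions w js (f + g) = contractions w js f + contractions w js g"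
  and contractions_escale: "contractions w js (escale r f) = escale r (contractions w js f)"
  and contractions_zero: "contractions w js 0 = 0"
  by (induction js) (simp_all add: contraction_add contraction_escale contraction_zero)

lemma contractions_sum: "contractions w js (sum F A) = (\<Sum>a\<in>A. contractions w js (F a))"
  by (induction A rule: infinite_finite_induct) (simp_all add: contractions_add contractions_zero)

lemma contractions_diff: "contractions w js (f - g) = contractions w js f - contractions w js g"
  by (induction js) (simp_all add: contraction_diff)

lemma contraction_contractions:
  "contraction v (contractions w js f) = escale ((- 1) ^ length js) (contractions w js (contraction v f))"
proof (induction js)
  case (Cons j js)
  then show ?case
    by (simp add: contraction_anticomm[of v "w j"] contraction_escale escale.scale_minus_left)
qed simp

text \<open>Anticommutation moves the outer factor inwards, up to sign, until it meets its other
  copy; there the square is zero.\<close>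

lemma contraction_contractions_eq_0:
  "j \<in> set js \<Longrightarrow> contraction (w j) (contractions w js f) = 0"
proof (induction js)
  case (Cons a js)
  then show ?case
    by (cases "a = j") (simp_all add: contraction_twice contraction_anticomm[of "w j" "w a"] contraction_zero)
qed simp

definition contraction_set ::
    "(nat \<Rightarrow> 'n \<Rightarrow> 'r::comm_ring_1) \<Rightarrow> nat set \<Rightarrow> ('r, 'n::{finite,linorder}) exterior \<Rightarrow> ('r, 'n) exterior" where
  "contraction_set w I = contractions w (sorted_list_of_set I)"

lemma contraction_set_empty [simp]: "contraction_set w {} f = f"
  by (simp add: contraction_set_def)

text \<open>Each swap of neighbouring contractions changes the sign. The sign stays unspecified:
  being a unit is all that the later arguments use.\<close>

lemma contractions_insort:
  "\<exists>e\<in>{1, - 1}. contraction (w j) (contractions w js f) = escale e (contractions w (insort j js) f)"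
proof (induction js)
  case (Cons a js)
  then obtain e where e: "e \<in> {1, - 1}"
    "contraction (w j) (contractions w js f) = escale e (contractions w (insort j js) f)" by blast
  then have "contraction (w j) (contractions w (a # js) f) =
      escale (- e) (contractions w (a # insort j js) f)"
    by (simp add: contraction_anticomm[of "w j" "w a"] contraction_escale escale.scale_minus_left)
  moreover have "- e \<in> {1, - 1}" using e by auto
  moreover have "\<exists>e\<in>{1, - 1}. contraction (w j) (contractions w (a # js) f) =
      escale e (contractions w (insort j (a # js)) f)" if "j \<le> a"
    using that by (intro bexI[of _ 1]) auto
  moreover have "insort j (a # js) = a # insort j js" if "\<not> j \<le> a"
    using that by simp
  ultimately show ?case by (cases "j \<le> a") (blast, metis)
qed (auto intro: bexI[of _ 1])

lemma contraction_contraction_set: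
  assumes "finite I" "j \<notin> I"
  shows "\<exists>e\<in>{1, - 1}. contraction (w j) (contraction_set w I f) = escale e (contraction_set w (insert j I) f)"
  using contractions_insort[of w j "sorted_list_of_set I" f] assms
  by (simp add: contraction_set_def sorted_list_of_set_insert_remove)

lemma contraction_contraction_set_eq_0:
  "finite I \<Longrightarrow> j \<in> I \<Longrightarrow> contraction (w j) (contraction_set w I f) = 0"
  by (simp add: contraction_set_def contraction_contractions_eq_0)

lemma contractions_contraction_set:
  assumes "finite I" "distinct js" "set js \<inter> I = {}"
  shows "\<exists>e\<in>{1, - 1}. contractions w js (contraction_set w I f) = escale e (contraction_set w (set js \<union> I) f)"
  using assms(2,3)
proof (induction js)
  case Nil
  then show ?case by (auto intro: bexI[of _ 1])
next
  case (Cons j js)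
  then have "distinct js" "set js \<inter> I = {}" by auto
  from Cons.IH[OF this] obtain e where e: "e \<in> {1, - 1}"
    "contractions w js (contraction_set w I f) = escale e (contraction_set w (set js \<union> I) f)" by blast
  moreover obtain e' where e': "e' \<in> {1, - 1}"
    "contraction (w j) (contraction_set w (set js \<union> I) f) =
      escale e' (contraction_set w (insert j (set js \<union> I)) f)"
    using contraction_contraction_set[of "set js \<union> I" j w f] Cons.prems assms(1)
    by (metis Un_iff disjoint_iff distinct.simps(2) finite_Un finite_set list.set_intros(1))
  ultimately show ?case
    by (intro bexI[of _ "e * e'"]) (auto simp: contraction_escale)
qed

lemma contractions_contraction_set_eq_0:
  assumes "finite I" "set js \<inter> I \<noteq> {}"
  shows "contractions w js (contraction_set w I f) = 0"
  using assms(2)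
proof (induction js)
  case (Cons j js)
  show ?case
  proof (cases "j \<in> I")
    case True
    \<comment> \<open>The repeated contraction is considered in innermost position, next to
      \<open>contraction_set w I f\<close>; moving it outwards costs only a sign.\<close>
    then have "contractions w js (contraction (w j) (contraction_set w I f)) = 0"
      using assms(1) by (simp add: contraction_contraction_set_eq_0 contractions_zero)
    then show ?thesis by (simp add: contraction_contractions)
  next
    case False
    then show ?thesis using Cons by (simp add: contraction_zero)
  qed
qed simp

lemma contractions_eq_contraction_set:
  assumes "distinct js"
  shows "\<exists>e\<in>{1, - 1}. contractions w js f = escale e (contraction_set w (set js) f)"
  using contractions_contraction_set[of "{}" js w f] assms by simp

lemma contractions_eq_0:
  assumes "\<not> distinct js"
  shows "contractions w js f = 0"
  using assms by (induction js) (auto simp: contraction_contractions_eq_0 contraction_zero)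

lemma contraction_set_contraction_set:
  assumes "finite I" "finite J" "J \<inter> I = {}"
  shows "\<exists>e\<in>{1, - 1}. contraction_set w J (contraction_set w I f) = escale e (contraction_set w (J \<union> I) f)"
  using contractions_contraction_set[of I "sorted_list_of_set J" w f] assms
  unfolding contraction_set_def[of w J] by simp

lemma contraction_set_contraction_set_eq_0:
  "finite I \<Longrightarrow> finite J \<Longrightarrow> J \<inter> I \<noteq> {} \<Longrightarrow> contraction_set w J (contraction_set w I f) = 0"
  using contractions_contraction_set_eq_0[of I "sorted_list_of_set J" w f]
  unfolding contraction_set_def[of w J] by simp

lemma contraction_set_linear:
  "contraction_set w I (f + h) = contraction_set w I f + contraction_set w I h"
  "contraction_set w I (f - h) = contraction_set w I f - contraction_set w I h"
  "contraction_set w I (escale p f) = escale p (contraction_set w I f)"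
  "contraction_set w I (sum F A) = (\<Sum>a\<in>A. contraction_set w I (F a))"
  by (simp_all add: contraction_set_def contractions_add contractions_diff contractions_escale contractions_sum)

section \<open>Exterior degree\<close>

definition pure_form :: "nat \<Rightarrow> ('r::comm_ring_1, 'n::{finite,linorder}) exterior \<Rightarrow> bool" where
  "pure_form r f \<longleftrightarrow> (\<forall>S. ecoeff f S \<noteq> 0 \<longrightarrow> card S = r)"

lemma pure_form_dxs: "pure_form (card S) (dxs S)"
  by (simp add: pure_form_def ecoeff_dxs)

lemma pure_form_contraction:
  assumes "pure_form (Suc r) f"
  shows "pure_form r (contraction w f)"
  unfolding pure_form_def
proof (intro allI impI)
  fix T assume T: "ecoeff (contraction w f) T \<noteq> 0"
  have "\<exists>s\<in>- T. (- 1) ^ below s T * w s * ecoeff f (insert s T) \<noteq> 0"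
    using T unfolding ecoeff_contraction by (rule sum.not_neutral_contains_not_neutral) blast
  then obtain s where "s \<notin> T" "ecoeff f (insert s T) \<noteq> 0" by force
  then show "card T = r" using assms by (fastforce simp: pure_form_def)
qed

lemma pure_form_contractions:
  "pure_form (length js + r) f \<Longrightarrow> pure_form r (contractions w js f)"
proof (induction js arbitrary: r)
  case (Cons j js)
  then show ?case using Cons.IH[of "Suc r"] by (auto intro: pure_form_contraction)
qed simp

lemma pure_form_ecoeff_empty: "pure_form r f \<Longrightarrow> r \<noteq> 0 \<Longrightarrow> ecoeff f {} = 0"
  by (auto simp: pure_form_def)

lemma pure_form_0: "pure_form 0 f \<Longrightarrow> f = escale (ecoeff f {}) 1"
  by (rule exterior_eqI) (auto simp: pure_form_def ecoeff_dxs simp flip: dxs_empty)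

lemma pure_form_contraction_0:
  assumes "pure_form 0 f"
  shows "contraction w f = 0"
  by (subst pure_form_0[OF assms]) (simp add: contraction_escale contraction_one)

text \<open>Each contraction lowers the exterior degree by one, and a form of degree
  \<open>0\<close> is killed by the next one.\<close>

lemma contractions_eq_0_if_degree:
  "pure_form r f \<Longrightarrow> r < length js \<Longrightarrow> contractions w js f = 0"
proof (induction js)
  case (Cons j js)
  show ?case
  proof (cases "r < length js")
    case False
    then have "pure_form 0 (contractions w js f)"
      using Cons.prems by (intro pure_form_contractions) (simp add: less_Suc_eq)
    then show ?thesis by (simp add: pure_form_contraction_0)
  qed (use Cons in \<open>simp add: contraction_zero\<close>)
qed simp

text \<open>The forms \<open>\<theta> j\<close> are, up to sign, \<open>contractions w js f\<close> with the factor \<open>j\<close> left out.\<close>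

lemma contractions_dx_mult:
  "\<exists>\<theta>. \<forall>i. contractions w js (dx i * f) =
     (\<Sum>j\<in>set js. escale (w j i) (\<theta> j)) + escale ((- 1) ^ length js) (dx i * contractions w js f)"
proof (induction js)
  case (Cons a js)
  then obtain \<theta> where \<theta>: "\<And>i. contractions w js (dx i * f) =
     (\<Sum>j\<in>set js. escale (w j i) (\<theta> j)) + escale ((- 1) ^ length js) (dx i * contractions w js f)"
    by blast
  \<comment> \<open>The first summand contracts the old forms once more, the second comes from
    contracting \<open>dx i\<close> itself with \<open>w a\<close>. As \<open>a\<close> may already
    occur in \<open>js\<close>, both can be present.\<close>
  define \<theta>' where "\<theta>' j = (if j \<in> set js then contraction (w a) (\<theta> j) else 0) +
    (if j = a then escale ((- 1) ^ length js) (contractions w js f) else 0)" for j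
  have "contractions w (a # js) (dx i * f) =
     (\<Sum>j\<in>set (a # js). escale (w j i) (\<theta>' j)) +
     escale ((- 1) ^ length (a # js)) (dx i * contractions w (a # js) f)" for i
  proof -
    have "(\<Sum>j\<in>set (a # js). escale (w j i) (\<theta>' j)) =
        (\<Sum>j\<in>set (a # js). if j \<in> set js then escale (w j i) (contraction (w a) (\<theta> j)) else 0) +
        (\<Sum>j\<in>set (a # js). if j = a then escale (w j i) (escale ((- 1) ^ length js) (contractions w js f)) else 0)"
      unfolding sum.distrib[symmetric]
      by (rule sum.cong) (auto simp: \<theta>'_def escale.scale_right_distrib)
    also have "\<dots> = (\<Sum>j\<in>set js. escale (w j i) (contraction (w a) (\<theta> j))) +
        escale (w a i * (- 1) ^ length js) (contractions w js f)"
      by (subst sum.inter_restrict[symmetric]) (auto intro!: sum.cong)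
    finally show ?thesis
      by (simp add: \<theta> contraction_add contraction_sum contraction_escale contraction_dx_mult
          escale.scale_right_diff_distrib escale.scale_minus_left mult.commute)
  qed
  then show ?case by blast
qed (auto intro!: exI[of _ "\<lambda>_. 0"])

section \<open>The determinant and Cramer's rule\<close>

text \<open>Up to sign, the determinant of the matrix \<open>w j i\<close>. Rows are numbered by
  \<open>nat\<close> and columns by \<open>'n\<close>, and in this form the Leibniz rule yields the
  cofactors.\<close>

definition top_contraction :: "(nat \<Rightarrow> 'n::{finite,linorder} \<Rightarrow> 'r::comm_ring_1) \<Rightarrow> 'r" where
  "top_contraction w = ecoeff (contractions w [0..<CARD('n)] (dxs UNIV :: ('r, 'n) exterior)) {}"

lemma contractions_dxs_UNIV:
  fixes w :: "nat \<Rightarrow> 'n::{finite,linorder} \<Rightarrow> 'r::comm_ring_1"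
  shows "contractions w [0..<CARD('n)] (dxs UNIV) = escale (top_contraction w) 1"
proof -
  have "pure_form 0 (contractions w [0..<CARD('n)] (dxs UNIV))"
    by (rule pure_form_contractions) (use pure_form_dxs[of UNIV] in auto)
  then show ?thesis unfolding top_contraction_def by (rule pure_form_0)
qed

lemma ecoeff_dx_singleton: "ecoeff (dx i) {k} = (if i = k then 1 else 0)"
  by (auto simp: dx_def ecoeff_dxs)

text \<open>Cramer's rule: \<open>n + 1\<close> contractions of \<open>dx\<^sub>i dx\<^sub>1 \<dots> dx\<^sub>n = 0\<close> express \<open>dx\<^sub>i\<close>,
  multiplied by the determinant, through the forms \<open>\<theta> j\<close>.\<close>

lemma ex_cofactors:
  fixes w :: "nat \<Rightarrow> 'n::{finite,linorder} \<Rightarrow> 'r::comm_ring_1"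
  shows "\<exists>u. \<forall>i k. (\<Sum>j<CARD('n). u j k * w j i) = (if i = k then top_contraction w else 0)"
proof -
  obtain \<theta> where \<theta>: "\<And>i. contractions w [0..<CARD('n)] (dx i * dxs UNIV) =
     (\<Sum>j\<in>set [0..<CARD('n)]. escale (w j i) (\<theta> j)) +
     escale ((- 1) ^ length [0..<CARD('n)]) (dx i * contractions w [0..<CARD('n)] (dxs UNIV))"
    using contractions_dx_mult by blast
  \<comment> \<open>Obtained by solving the coefficient of \<open>dx k\<close> in the identity for
    \<open>\<theta>\<close> for the determinant; \<open>(- 1) ^ CARD('n)\<close> is its own
    inverse.\<close>
  define u where "u j k = - ((- 1) ^ CARD('n)) * ecoeff (\<theta> j) {k}" for j k
  have "(\<Sum>j<CARD('n). u j k * w j i) = (if i = k then top_contraction w else 0)" for i k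
  proof -
    have "0 = (\<Sum>j<CARD('n). w j i * ecoeff (\<theta> j) {k}) +
       (- 1) ^ CARD('n) * (if i = k then top_contraction w else 0)"
      using \<theta>[of i, THEN arg_cong, of "\<lambda>f. ecoeff f {k}"]
      by (simp add: dx_mult_dxs contractions_zero contractions_dxs_UNIV escale_mult_right
          ecoeff_dx_singleton atLeast0LessThan if_distrib cong: if_cong)
    then have "(- 1) ^ CARD('n) * (0::'r) = (- 1) ^ CARD('n) * (\<Sum>j<CARD('n). w j i * ecoeff (\<theta> j) {k}) +
       ((- 1) ^ CARD('n) * (- 1) ^ CARD('n)) * (if i = k then top_contraction w else 0)"
      by (metis (no_types, lifting) distrib_left mult.assoc)
    then show ?thesis
      by (simp add: u_def sum_negf sum_distrib_left mult_ac minus_one_power_twice eq_neg_iff_add_eq_0 add.commute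
          neg_eq_iff_add_eq_0)
  qed
  then show ?thesis by blast
qed

lemma contraction_sum_left:
  "contraction (\<lambda>i. \<Sum>j\<in>A. c j * w j i) f = (\<Sum>j\<in>A. escale (c j) (contraction (w j) f))"
  by (rule exterior_eqI)
    (simp add: ecoeff_contraction sum_distrib_left sum_distrib_right mult_ac, rule sum.swap)

text \<open>By Cramer's rule, the contraction with a coordinate vector is, after multiplication by
  the nonzero determinant, a combination of the contractions with the \<open>w j\<close>;
  contractions with coordinate vectors read off every coefficient of \<open>f\<close>.\<close>

lemma eq_0_if_contraction_sets:
  fixes w :: "nat \<Rightarrow> 'n::{finite,linorder} \<Rightarrow> 'r::idom"
  assumes L: "top_contraction w \<noteq> 0"
    and f: "\<And>I. I \<subseteq> {0..<CARD('n)} \<Longrightarrow> ecoeff (contraction_set w I f) {} = 0"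
  shows "f = 0"
proof -
  obtain u where u: "\<And>i k. (\<Sum>j<CARD('n). u j k * w j i) = (if i = k then top_contraction w else 0)"
    using ex_cofactors[of w] by blast
  \<comment> \<open>Arbitrary lists replace sets here so that \<open>N\<close> is closed under a
    further innermost contraction, whatever its index.\<close>
  define N where "N = {f. \<forall>js. set js \<subseteq> {0..<CARD('n)} \<longrightarrow> ecoeff (contractions w js f) {} = 0}"
  have N: "contraction (\<lambda>i. if i = k then 1 else 0) f \<in> N" if "f \<in> N" for f k
  proof -
    have "escale (top_contraction w) (contraction (\<lambda>i. if i = k then 1 else 0) f) =
        (\<Sum>j<CARD('n). escale (u j k) (contraction (w j) f))"
      unfolding contraction_sum_left[symmetric] u
      by (rule exterior_eqI) (auto simp: ecoeff_contraction sum_distrib_left intro!: sum.cong)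
    moreover have "ecoeff (contractions w js (contraction (w j) f)) {} = 0"
      if "set js \<subseteq> {0..<CARD('n)}" "j < CARD('n)" for js j
      using \<open>f \<in> N\<close> that unfolding N_def mem_Collect_eq by (auto dest!: spec[of _ "js @ [j]"])
    ultimately have "ecoeff (contractions w js (escale (top_contraction w) (contraction (\<lambda>i. if i = k then 1 else 0) f))) {} = 0"
      if "set js \<subseteq> {0..<CARD('n)}" for js
      using that by (simp only: contractions_sum contractions_escale) simp
    then show ?thesis using L by (simp add: N_def contractions_escale)
  qed
  have coeff: "ecoeff f S = 0" if "f \<in> N" for f S
    using finite[of S] that
  proof (induction S arbitrary: f rule: finite_induct)
    case empty
    then show ?case by (auto simp: N_def dest: spec[of _ "[]"])
  next
    case (insert k S)
    have "ecoeff (contraction (\<lambda>i. if i = k then 1 else 0) f) S =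
        (\<Sum>s\<in>- S. if s = k then (- 1) ^ below k S * ecoeff f (insert k S) else 0)"
      unfolding ecoeff_contraction by (rule sum.cong) auto
    then have "ecoeff (contraction (\<lambda>i. if i = k then 1 else 0) f) S = (- 1) ^ below k S * ecoeff f (insert k S)"
      using insert(2) by simp
    then show ?case using insert.IH[OF N[OF insert.prems]] by simp
  qed
  have "f \<in> N"
    unfolding N_def
  proof (safe, goal_cases)
    case (1 js)
    show ?case
    proof (cases "distinct js")
      case True
      then show ?thesis using f[OF 1] contractions_eq_contraction_set[OF True, of w f] by auto
    qed (simp add: contractions_eq_0)
  qed
  then show ?thesis by (intro exterior_eqI) (simp add: coeff)
qed

section \<open>Pairing with the contractions of the top form\<close>

lemma ecoeff_contraction_set_one:
  fixes w :: "nat \<Rightarrow> 'n::{finite,linorder} \<Rightarrow> 'r::comm_ring_1"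
  assumes "finite J"
  shows "ecoeff (contraction_set w J 1) {} = (if J = {} then 1 else 0)"
proof (cases "J = {}")
  case False
  then have "0 < length (sorted_list_of_set J)" using assms by (simp add: card_gt_0_iff)
  moreover have "pure_form 0 (1 :: ('r, 'n) exterior)" by (simp add: pure_form_def ecoeff_one)
  ultimately show ?thesis
    using False contractions_eq_0_if_degree[of 0 "1 :: ('r, 'n) exterior" "sorted_list_of_set J" w]
    by (simp add: contraction_set_def)
qed (simp add: contraction_set_def ecoeff_one)

text \<open>If \<open>J\<close> meets \<open>I\<close>, a contraction is repeated; otherwise
  \<open>J \<union> I\<close> misses an index, and a form of positive exterior degree is
  left.\<close>

lemma ecoeff_contraction_set_top_eq_0:
  fixes w :: "nat \<Rightarrow> 'n::{finite,linorder} \<Rightarrow> 'r::comm_ring_1"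
  assumes I: "I \<subseteq> {0..<CARD('n)}" and J: "J \<subseteq> {0..<CARD('n)}" "J \<noteq> {0..<CARD('n)} - I"
  shows "ecoeff (contraction_set w J (contraction_set w I (dxs UNIV))) {} = 0"
proof -
  have fin: "finite I" "finite J" using I J finite_subset by blast+
  show ?thesis
  proof (cases "J \<inter> I = {}")
    case True
    obtain e where "contraction_set w J (contraction_set w I (dxs UNIV)) =
        escale e (contraction_set w (J \<union> I) (dxs UNIV))"
      using contraction_set_contraction_set[OF fin True] by blast
    moreover have "J \<union> I \<subset> {0..<CARD('n)}" using True I J by auto
    then have "card (J \<union> I) < CARD('n)"
      using psubset_card_mono[of "{0..<CARD('n)}" "J \<union> I"] by simp
    then have "pure_form (CARD('n) - card (J \<union> I)) (contraction_set w (J \<union> I) (dxs UNIV))"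
      using pure_form_dxs[of "UNIV :: 'n set"] fin
      unfolding contraction_set_def by (intro pure_form_contractions) simp
    then have "ecoeff (contraction_set w (J \<union> I) (dxs UNIV)) {} = 0"
      using \<open>card (J \<union> I) < CARD('n)\<close> by (intro pure_form_ecoeff_empty) auto
    ultimately show ?thesis by simp
  next
    case False
    then show ?thesis using contraction_set_contraction_set_eq_0[OF fin, of w "dxs UNIV"] by simp
  qed
qed

text \<open>All \<open>CARD('n)\<close> contractions occur once, so sorting them leaves the
  determinant up to sign. With the preceding lemma, contracting along complements is dual to the
  contractions of the top form, up to this factor.\<close>

lemma ecoeff_contraction_set_top:
  fixes w :: "nat \<Rightarrow> 'n::{finite,linorder} \<Rightarrow> 'r::comm_ring_1"
  assumes I: "I \<subseteq> {0..<CARD('n)}"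
  shows "\<exists>e\<in>{1, - 1}. ecoeff (contraction_set w ({0..<CARD('n)} - I) (contraction_set w I (dxs UNIV))) {} =
    e * top_contraction w"
proof -
  have fin: "finite I" using I finite_subset by blast
  have "({0..<CARD('n)} - I) \<inter> I = {}" by auto
  moreover have "{0..<CARD('n)} - I \<union> I = {0..<CARD('n)}" using I by auto
  ultimately obtain e where e: "e \<in> {1, - 1}"
    "contraction_set w ({0..<CARD('n)} - I) (contraction_set w I (dxs UNIV)) =
      escale e (contraction_set w {0..<CARD('n)} (dxs UNIV))"
    using contraction_set_contraction_set[of I "{0..<CARD('n)} - I" w "dxs UNIV"] fin
    by (metis finite_Diff finite_atLeastLessThan)
  show ?thesis
    by (rule bexI[OF _ e(1)]) (simp add: e(2), simp add: contraction_set_def top_contraction_def)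
qed


section \<open>Substituting linear combinations of the generators\<close>

lemma ordered_prod_cong:
  "(\<And>i. i \<in> S \<Longrightarrow> y i = z i) \<Longrightarrow> ordered_prod y S = ordered_prod z S"
  unfolding ordered_prod_def by (intro arg_cong[of _ _ prod_list] map_cong) auto

lemma ordered_prod_pull_out2:
  fixes y :: "'n::{finite,linorder} \<Rightarrow> 'm::ring_1"
  assumes sq: "\<And>i. y i * y i = 0" and ac: "\<And>i j. y i * y j = - (y j * y i)"
    and ab: "a \<in> S" "b \<in> S" "a \<noteq> b"
  shows "y a * (y b * ordered_prod y (S - {a, b})) =
    (- 1) ^ (below b (S - {a, b}) + below a (S - {a})) * ordered_prod y S"
proof -
  have com: "y a * ((- 1) ^ k * z) = (- 1) ^ k * (y a * z)" for k z
    by (cases "even k") auto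
  have "insert b (S - {a, b}) = S - {a}" using ab by auto
  moreover have "insert a (S - {a}) = S" using ab by auto
  ultimately show ?thesis
    using mult_ordered_prod[where y = y and i = b and T = "S - {a, b}", OF sq ac]
      mult_ordered_prod[where y = y and i = a and T = "S - {a}", OF sq ac]
    by (simp add: com power_add mult.assoc)
qed

lemma minus_one_power_mult_cancel:
  fixes x y :: "'m::ring_1"
  shows "(- 1) ^ k * x = (- 1) ^ k * y \<longleftrightarrow> x = y"
  by (cases "even k") auto

text \<open>Once the factors at \<open>a\<close> and \<open>b\<close> are pulled to the front, with
  the same sign on both sides, the remaining product is unchanged and the two exchanged factors
  anticommute.\<close>

lemma ordered_prod_transpose:
  fixes y :: "'n::{finite,linorder} \<Rightarrow> 'm::ring_1"
  assumes sq: "\<And>i. y i * y i = 0" and ac: "\<And>i j. y i * y j = - (y j * y i)"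
    and ab: "a \<in> S" "b \<in> S" "a \<noteq> b"
  shows "ordered_prod (y \<circ> Transposition.transpose a b) S = - ordered_prod y S"
proof -
  let ?z = "y \<circ> Transposition.transpose a b" and ?k = "below b (S - {a, b}) + below a (S - {a})"
  have rest: "ordered_prod ?z (S - {a, b}) = ordered_prod y (S - {a, b})"
    by (rule ordered_prod_cong) (auto simp: Transposition.transpose_def)
  have "(- 1) ^ ?k * ordered_prod ?z S = ?z a * (?z b * ordered_prod ?z (S - {a, b}))"
    by (rule ordered_prod_pull_out2[OF _ _ ab, symmetric]) (unfold o_apply, rule sq, rule ac)
  also have "\<dots> = - (y a * (y b * ordered_prod y (S - {a, b})))"
    by (simp add: rest ac[of b a] flip: mult.assoc)
  also have "\<dots> = (- 1) ^ ?k * (- ordered_prod y S)"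
    by (subst ordered_prod_pull_out2[OF sq ac ab]) simp
  finally show ?thesis by (simp only: minus_one_power_mult_cancel)
qed

lemma ordered_prod_eq_0:
  fixes y :: "'n::{finite,linorder} \<Rightarrow> 'm::ring_1"
  assumes sq: "\<And>i. y i * y i = 0" and ac: "\<And>i j. y i * y j = - (y j * y i)"
    and ab: "a \<in> S" "b \<in> S" "a \<noteq> b" "y a = y b"
  shows "ordered_prod y S = 0"
proof -
  have "(- 1) ^ (below b (S - {a, b}) + below a (S - {a})) * ordered_prod y S =
      (- 1) ^ (below b (S - {a, b}) + below a (S - {a})) * 0"
    using ordered_prod_pull_out2[where y = y, OF sq ac ab(1-3)] ab(4) by (simp add: sq flip: mult.assoc)
  then show ?thesis by (simp only: minus_one_power_mult_cancel)
qed

lemma ordered_prod_permutes: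
  fixes y :: "'n::{finite,linorder} \<Rightarrow> 'm::ring_1"
  assumes sq: "\<And>i. y i * y i = 0" and ac: "\<And>i j. y i * y j = - (y j * y i)"
    and \<sigma>: "\<sigma> permutes UNIV"
  shows "ordered_prod (y \<circ> \<sigma>) UNIV = of_int (sign \<sigma>) * ordered_prod y UNIV"
  using finite \<sigma>
proof (induction rule: permutes_rev_induct)
  case (swap a b p)
  have "sign (p \<circ> Transposition.transpose a b) = - sign p"
    using swap(3) permutes_imp_permutation[OF finite swap(4)]
    by (simp add: sign_compose sign_swap_id permutation_swap_id)
  moreover have "ordered_prod (y \<circ> p \<circ> Transposition.transpose a b) UNIV = - ordered_prod (y \<circ> p) UNIV"
    using swap(1-3) by (intro ordered_prod_transpose) (unfold o_apply, rule sq, rule ac, auto)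
  ultimately show ?case using swap(5) by (metis comp_assoc minus_mult_left of_int_minus)
qed simp

text \<open>The distributive law for a noncommutative product: \<open>f\<close> picks one summand
  from each factor.\<close>

lemma ordered_prod_linear_comb_dx:
  fixes c :: "'n::{finite,linorder} \<Rightarrow> 'n \<Rightarrow> 'r::comm_ring_1"
  shows "ordered_prod (\<lambda>i. \<Sum>j\<in>UNIV. escale (c i j) (dx j)) S =
    (\<Sum>f\<in>S \<rightarrow>\<^sub>E UNIV. escale (\<Prod>i\<in>S. c i (f i)) (ordered_prod (\<lambda>i. dx (f i)) S))"
proof (induction S rule: set_min_induct)
  case (insert i T)
  then have i: "i \<notin> T" by auto
  let ?g = "\<lambda>(j, f). f(i := j)"
  have "(\<Sum>f\<in>insert i T \<rightarrow>\<^sub>E UNIV. escale (\<Prod>k\<in>insert i T. c k (f k)) (ordered_prod (\<lambda>k. dx (f k)) (insert i T))) =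
      (\<Sum>(j, f)\<in>UNIV \<times> (T \<rightarrow>\<^sub>E UNIV). escale (\<Prod>k\<in>insert i T. c k ((f(i := j)) k))
        (ordered_prod (\<lambda>k. dx ((f(i := j)) k)) (insert i T)))"
    unfolding PiE_insert_eq by (subst sum.reindex[OF inj_combinator[OF i]]) (simp add: case_prod_unfold o_def)
  also have "\<dots> = (\<Sum>(j, f)\<in>UNIV \<times> (T \<rightarrow>\<^sub>E UNIV). escale (c i j) (dx j) *
      escale (\<Prod>k\<in>T. c k (f k)) (ordered_prod (\<lambda>k. dx (f k)) T))"
  proof (intro sum.cong refl, clarify)
    fix j f
    have "(\<Prod>k\<in>T. c k ((f(i := j)) k)) = (\<Prod>k\<in>T. c k (f k))"
      by (rule prod.cong) (use i in auto)
    moreover have "ordered_prod (\<lambda>k. dx ((f(i := j)) k)) T = (ordered_prod (\<lambda>k. dx (f k)) T :: ('r, 'n) exterior)"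
      by (rule ordered_prod_cong) (use i in auto)
    ultimately show "escale (\<Prod>k\<in>insert i T. c k ((f(i := j)) k))
        (ordered_prod (\<lambda>k. dx ((f(i := j)) k)) (insert i T)) =
      escale (c i j) (dx j) * escale (\<Prod>k\<in>T. c k (f k)) (ordered_prod (\<lambda>k. dx (f k)) T)"
      using i insert(1) by (simp add: ordered_prod_insert_min escale_mult_left escale_mult_right mult.commute)
  qed
  also have "\<dots> = (\<Sum>j\<in>UNIV. escale (c i j) (dx j)) *
      (\<Sum>f\<in>T \<rightarrow>\<^sub>E UNIV. escale (\<Prod>k\<in>T. c k (f k)) (ordered_prod (\<lambda>k. dx (f k)) T))"
    by (simp add: sum_product sum.cartesian_product)
  finally show ?case using insert by (simp add: ordered_prod_insert_min)
qed simp

text \<open>In the expanded product, choices that repeat a generator vanish and a permutation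
  contributes its sign, which leaves the Leibniz formula of the determinant.\<close>

lemma ordered_prod_linear_comb_dx_UNIV:
  fixes A :: "'r::comm_ring_1^'n::{finite,linorder}^'n::{finite,linorder}"
  shows "ordered_prod (\<lambda>i. \<Sum>j\<in>UNIV. escale (A $ i $ j) (dx j)) UNIV = escale (det A) (dxs UNIV)"
proof -
  have not_perm: "ordered_prod (\<lambda>i. dx (f i)) UNIV = (0 :: ('r, 'n) exterior)"
    if "\<not> f permutes UNIV" for f :: "'n \<Rightarrow> 'n"
  proof -
    have "\<not> inj f"
      using that bij_imp_permutes[of f UNIV] finite_UNIV_inj_surj[of f] by (auto simp: bij_def)
    then obtain a b where "a \<noteq> b" "f a = f b" by (auto simp: inj_on_def)
    then show ?thesis
      by (intro ordered_prod_eq_0[of _ a _ b] dx_square dx_anticomm) auto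
  qed
  have perm: "ordered_prod (\<lambda>i. dx (f i)) UNIV = (escale (of_int (sign f)) (dxs UNIV) :: ('r, 'n) exterior)"
    if "f permutes UNIV" for f :: "'n \<Rightarrow> 'n"
  proof -
    have "ordered_prod (dx \<circ> f) UNIV = of_int (sign f) * (ordered_prod dx UNIV :: ('r, 'n) exterior)"
      by (rule ordered_prod_permutes[OF dx_square dx_anticomm that])
    then show ?thesis by (simp add: o_def dxs_eq_ordered_prod sign_def escale.scale_minus_left)
  qed
  have "ordered_prod (\<lambda>i. \<Sum>j\<in>UNIV. escale (A $ i $ j) (dx j)) UNIV =
      (\<Sum>f\<in>UNIV. escale (\<Prod>i\<in>UNIV. A $ i $ f i) (ordered_prod (\<lambda>i. dx (f i)) UNIV))"
    by (simp add: ordered_prod_linear_comb_dx PiE_UNIV_domain)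
  also have "\<dots> = (\<Sum>f | f permutes UNIV. escale (\<Prod>i\<in>UNIV. A $ i $ f i) (ordered_prod (\<lambda>i. dx (f i)) UNIV))"
    by (rule sum.mono_neutral_right) (auto simp: not_perm)
  also have "\<dots> = escale (det A) (dxs UNIV)"
    by (simp add: det_def escale.scale_sum_left perm mult.commute)
  finally show ?thesis .
qed


section \<open>Linear forms and homogeneous polynomials\<close>

lemma finite_field_power_CARD:
  fixes x :: "'a::{field,finite}"
  shows "x ^ CARD('a) = x"
proof (cases "x = 0")
  case False
  have "(\<Prod>y\<in>UNIV - {0}. y) = (\<Prod>y\<in>UNIV - {0}. x * y)"
    by (rule prod.reindex_bij_witness[of _ "\<lambda>y. x * y" "\<lambda>y. y / x"]) (use False in auto)
  then have "(\<Prod>y\<in>UNIV - {0 :: 'a}. y) = x ^ (CARD('a) - 1) * (\<Prod>y\<in>UNIV - {0}. y)"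
    by (simp add: prod.distrib card_Diff_singleton)
  moreover have "(\<Prod>y\<in>UNIV - {0 :: 'a}. y) \<noteq> 0" by simp
  ultimately have "x ^ (CARD('a) - 1) = 1" by simp
  then show ?thesis
    by (metis finite_UNIV_card_ge_0 finite mult.right_neutral power_eq_if neq0_conv)
qed (simp add: power_0_left)

lemma finite_field_power_CARD_power:
  fixes x :: "'a::{field,finite}"
  shows "x ^ (CARD('a) ^ j) = x"
  by (induction j) (simp_all add: power_mult finite_field_power_CARD)

lemma cst_power: "cst (a ^ k) = cst a ^ k"
  by (induction k) simp_all

lemma cst_sum: "cst (sum f A) = (\<Sum>a\<in>A. cst (f a))"
  by (induction A rule: infinite_finite_induct) simp_all

lemma cst_prod: "cst (prod f A) = (\<Prod>a\<in>A. cst (f a))"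
  by (induction A rule: infinite_finite_induct) simp_all

lemma cst_uminus: "cst (- a) = - cst a"
  by (simp add: cst_def single_uminus)

lemma cst_diff: "cst (a - b) = cst a - cst b"
  by (simp add: cst_def single_diff)

lemma of_nat_eq_cst: "of_nat d = (cst (of_nat d) :: ('a::comm_ring_1, 'n) mpoly)"
  by (induction d) simp_all

lemma of_int_eq_cst: "of_int z = (cst (of_int z) :: ('a::comm_ring_1, 'n) mpoly)"
  by (cases z rule: int_cases2) (simp_all add: of_nat_eq_cst cst_uminus)

text \<open>Translation by \<open>1\<close> permutes the ring and therefore preserves the sum of all
  its elements.\<close>

lemma of_nat_CARD_eq_0: "of_nat CARD('a) = (0 :: 'a::{finite,ring_1})"
proof -
  have "(\<Sum>x\<in>UNIV. x) = (\<Sum>x\<in>UNIV. x + 1 :: 'a)"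
    by (rule sum.reindex_bij_witness[of _ "\<lambda>x. x + 1" "\<lambda>x. x - 1"]) auto
  then show ?thesis by (simp add: sum.distrib)
qed

lemma CHAR_mpoly:
  assumes "prime p" "CARD('a::{field,finite}) = p ^ k"
  shows "CHAR(('a, 'n::linorder) mpoly) = p"
proof -
  have "of_nat p ^ k = (0 :: 'a)"
    using of_nat_CARD_eq_0[where 'a = 'a] by (simp add: assms(2))
  then have "of_nat p = (0 :: ('a, 'n) mpoly)" by (simp add: of_nat_eq_cst)
  then have "CHAR(('a, 'n) mpoly) dvd p" by (simp add: of_nat_eq_0_iff_char_dvd)
  moreover have "CHAR(('a, 'n) mpoly) \<noteq> 1" by simp
  ultimately show ?thesis using assms(1) by (metis prime_nat_iff)
qed

lemma frobenius_sum:
  fixes f :: "'i \<Rightarrow> ('a::{field,finite}, 'n::linorder) mpoly"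
  assumes "prime p" "CARD('a) = p ^ k"
  shows "sum f A ^ (CARD('a) ^ j) = (\<Sum>i\<in>A. f i ^ (CARD('a) ^ j))"
proof (rule freshmans_dream_sum')
  show "prime CHAR(('a, 'n) mpoly)" "CARD('a) ^ j = CHAR(('a, 'n) mpoly) ^ (k * j)"
    unfolding CHAR_mpoly[OF assms] using assms by (simp_all add: power_mult)
qed

lemma cst_power_CARD: "cst c ^ (CARD('a) ^ j) = cst (c :: 'a::{field,finite})"
  by (simp add: finite_field_power_CARD_power flip: cst_power)

section \<open>Linear forms and divisibility by them\<close>

definition linear_form :: "('n::finite \<Rightarrow> 'a::comm_ring_1) \<Rightarrow> ('a, 'n) mpoly" where
  "linear_form v = (\<Sum>i\<in>UNIV. cst (v i) * var i)"

lemma linear_form_power_CARD: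
  fixes v :: "'n::{finite,linorder} \<Rightarrow> 'a::{field,finite}"
  assumes "prime p" "CARD('a) = p ^ k"
  shows "linear_form v ^ (CARD('a) ^ j) = (\<Sum>i\<in>UNIV. cst (v i) * var i ^ (CARD('a) ^ j))"
  by (simp add: linear_form_def frobenius_sum[OF assms] power_mult_distrib cst_power_CARD)

lemma lookup_cst_mult: "Poly_Mapping.lookup (cst c * p) m = c * Poly_Mapping.lookup p m"
proof (induction p rule: poly_mapping_add_induct)
  case (single m' c')
  then show ?case by (simp add: cst_def mult_single lookup_single when_def)
qed (simp add: lookup_add algebra_simps)

lemma lookup_linear_form: "Poly_Mapping.lookup (linear_form v) (Poly_Mapping.single i 1) = v i"
proof -
  have "Poly_Mapping.lookup (cst (v j) * var j) (Poly_Mapping.single i 1) = (if j = i then v i else 0)" for j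
    by (auto simp: lookup_cst_mult var_def lookup_single when_def dest!: arg_cong[of _ _ Poly_Mapping.keys])
  then show ?thesis by (simp add: linear_form_def lookup_sum)
qed

lemma linear_form_eq_iff: "linear_form v = linear_form v' \<longleftrightarrow> v = v'"
  by (metis ext lookup_linear_form)

lemma mpsubst_eq_var: "mpsubst var p = p"
  by (induction p rule: poly_mapping_add_induct)
    (simp_all add: mpsubst_add mpsubst_single single_eq_prod_var[symmetric])

lemma mpsubst_zero: "mpsubst l 0 = 0"
  by (simp add: mpsubst_def)

lemma mpsubst_sum: "mpsubst l (sum f A) = (\<Sum>a\<in>A. mpsubst l (f a))"
  by (induction A rule: infinite_finite_induct) (simp_all add: mpsubst_add mpsubst_zero)

lemma mpsubst_linear_form: "mpsubst l (linear_form v) = (\<Sum>i\<in>UNIV. cst (v i) * l i)"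
  by (simp add: linear_form_def mpsubst_sum mpsubst_mult mpsubst_cst mpsubst_var)

lemma dvd_diff_mult:
  fixes a b c d l :: "'r::comm_ring_1"
  assumes "l dvd a - b" "l dvd c - d"
  shows "l dvd a * c - b * d"
proof -
  have "a * c - b * d = (a - b) * c + b * (c - d)" by (simp add: algebra_simps)
  then show ?thesis using assms by simp
qed

lemma dvd_mpsubst_diff:
  assumes "\<And>i. l dvd s i - t i"
  shows "l dvd mpsubst s p - mpsubst t p"
proof (induction p rule: poly_mapping_add_induct)
  case (single m c)
  have pow: "l dvd s i ^ k - t i ^ k" for i k
    by (induction k) (auto intro: dvd_diff_mult assms)
  have "l dvd (\<Prod>i\<in>A. s i ^ Poly_Mapping.lookup m i) - (\<Prod>i\<in>A. t i ^ Poly_Mapping.lookup m i)" for A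
    by (induction A rule: infinite_finite_induct) (auto intro: dvd_diff_mult pow)
  then show ?case
    unfolding mpsubst_single right_diff_distrib[symmetric] by (rule dvd_mult)
next
  case (add p q)
  have "mpsubst s (p + q) - mpsubst t (p + q) = (mpsubst s p - mpsubst t p) + (mpsubst s q - mpsubst t q)"
    by (simp add: mpsubst_add)
  then show ?case using add by (metis dvd_add)
qed

text \<open>The quotient of \<open>P\<^sub>n\<close> by a linear form with \<open>v m = 1\<close> is realised inside \<open>P\<^sub>n\<close> by
  eliminating \<open>x\<^sub>m\<close>.\<close>

definition eliminate :: "('n::finite \<Rightarrow> 'a::comm_ring_1) \<Rightarrow> 'n \<Rightarrow> ('a, 'n) mpoly \<Rightarrow> ('a, 'n) mpoly" where
  "eliminate v m = mpsubst (\<lambda>i. if i = m then var m - linear_form v else var i)"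

text \<open>The substitution kills the linear form because \<open>v m = 1\<close>, and it is the
  identity modulo the linear form.\<close>

lemma linear_form_dvd_iff:
  assumes "v m = 1"
  shows "linear_form v dvd p \<longleftrightarrow> eliminate v m p = 0"
proof
  have "eliminate v m (linear_form v) =
      (\<Sum>i\<in>UNIV. cst (v i) * var i - (if i = m then linear_form v else 0))"
    unfolding eliminate_def mpsubst_linear_form by (rule sum.cong) (auto simp: assms right_diff_distrib)
  then have "eliminate v m (linear_form v) = 0"
    by (simp add: sum_subtractf linear_form_def[symmetric])
  moreover assume "linear_form v dvd p"
  ultimately show "eliminate v m p = 0"
    by (auto simp: eliminate_def mpsubst_mult)
next
  have "linear_form v dvd eliminate v m p - mpsubst var p"
    unfolding eliminate_def by (rule dvd_mpsubst_diff) auto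
  moreover assume "eliminate v m p = 0"
  ultimately show "linear_form v dvd p" by (simp add: mpsubst_eq_var)
qed

text \<open>The linear form is prime: its multiples are the kernel of a multiplicative map into an
  integral domain.\<close>

lemma linear_form_dvd_multD:
  fixes v :: "'n::{finite,linorder} \<Rightarrow> 'a::field"
  assumes "v m = 1" "linear_form v dvd p * q"
  shows "linear_form v dvd p \<or> linear_form v dvd q"
  using assms(2) unfolding linear_form_dvd_iff[of v m, OF assms(1)] by (auto simp: eliminate_def mpsubst_mult)

section \<open>Homogeneous polynomials\<close>

definition homogeneous_poly :: "nat \<Rightarrow> ('a::comm_ring_1, 'n::finite) mpoly \<Rightarrow> bool" where
  "homogeneous_poly d p \<longleftrightarrow> (\<forall>m. Poly_Mapping.lookup p m \<noteq> 0 \<longrightarrow> (\<Sum>i\<in>UNIV. Poly_Mapping.lookup m i) = d)"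

lemma homogeneous_poly_0: "homogeneous_poly d 0"
  by (simp add: homogeneous_poly_def)

lemma homogeneous_poly_cst: "homogeneous_poly 0 (cst c)"
  by (auto simp: homogeneous_poly_def cst_def lookup_single when_def)

lemma homogeneous_poly_1: "homogeneous_poly 0 1"
  using homogeneous_poly_cst[of 1] by simp

lemma homogeneous_poly_var: "homogeneous_poly 1 (var i)"
  by (auto simp: homogeneous_poly_def var_def lookup_single when_def)

lemma homogeneous_poly_add: "homogeneous_poly d p \<Longrightarrow> homogeneous_poly d q \<Longrightarrow> homogeneous_poly d (p + q)"
  by (auto simp: homogeneous_poly_def lookup_add) (metis add_0)

lemma homogeneous_poly_sum:
  "(\<And>i. i \<in> A \<Longrightarrow> homogeneous_poly d (f i)) \<Longrightarrow> homogeneous_poly d (sum f A)"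
  by (induction A rule: infinite_finite_induct) (auto intro: homogeneous_poly_0 homogeneous_poly_add)

lemma lookup_mult_neq_0D:
  assumes "Poly_Mapping.lookup (p * q) m \<noteq> 0"
  obtains a b where "m = a + b" "Poly_Mapping.lookup p a \<noteq> 0" "Poly_Mapping.lookup q b \<noteq> 0"
proof -
  have "m \<in> Poly_Mapping.keys (p * q)" using assms by (simp add: in_keys_iff)
  then show thesis using keys_mult[of p q] that by (auto simp: in_keys_iff)
qed

lemma homogeneous_poly_mult:
  assumes "homogeneous_poly d p" "homogeneous_poly e q"
  shows "homogeneous_poly (d + e) (p * q)"
  using assms unfolding homogeneous_poly_def
  by (auto elim!: lookup_mult_neq_0D simp: lookup_add sum.distrib)

lemma homogeneous_poly_power: "homogeneous_poly d p \<Longrightarrow> homogeneous_poly (k * d) (p ^ k)"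
  by (induction k) (auto intro: homogeneous_poly_1 homogeneous_poly_mult)

lemma homogeneous_poly_prod:
  "(\<And>i. i \<in> A \<Longrightarrow> homogeneous_poly (d i) (f i)) \<Longrightarrow> homogeneous_poly (sum d A) (prod f A)"
  by (induction A rule: infinite_finite_induct) (auto intro: homogeneous_poly_1 homogeneous_poly_mult)

lemma homogeneous_poly_minus_one_power_mult: "homogeneous_poly d p \<Longrightarrow> homogeneous_poly d ((- 1) ^ k * p)"
  by (cases "even k") (auto simp: homogeneous_poly_def)

lemma homogeneous_poly_linear_form: "homogeneous_poly 1 (linear_form v)"
  unfolding linear_form_def
  by (intro homogeneous_poly_sum) (metis homogeneous_poly_mult homogeneous_poly_cst homogeneous_poly_var add_0)

lemma homogeneous_poly_eq_cst_mult:
  assumes "homogeneous_poly d p" "homogeneous_poly d (p * q)"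
  shows "p * q = cst (Poly_Mapping.lookup q 0) * p"
proof (rule poly_mapping_eqI)
  fix m
  define r where "r = q - cst (Poly_Mapping.lookup q 0)"
  have r0: "Poly_Mapping.lookup r 0 = 0"
    by (simp add: r_def lookup_minus cst_def)
  have eq: "p * q - cst (Poly_Mapping.lookup q 0) * p = p * r"
    by (simp add: r_def algebra_simps)
  have "Poly_Mapping.lookup (p * r) m = 0"
  proof (rule ccontr)
    assume nz: "Poly_Mapping.lookup (p * r) m \<noteq> 0"
    then obtain a b where ab: "m = a + b" "Poly_Mapping.lookup p a \<noteq> 0" "Poly_Mapping.lookup r b \<noteq> 0"
      by (rule lookup_mult_neq_0D)
    \<comment> \<open>In either case \<open>m\<close> has degree \<open>d\<close>. As
      \<open>a\<close> also has degree \<open>d\<close>, the factor \<open>b\<close> must be the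
      constant monomial, which does not occur in \<open>r\<close>.\<close>
    have "Poly_Mapping.lookup (p * q) m \<noteq> 0 \<or> Poly_Mapping.lookup p m \<noteq> 0"
      using nz unfolding eq[symmetric] by (auto simp: lookup_minus lookup_cst_mult)
    then have "(\<Sum>i\<in>UNIV. Poly_Mapping.lookup m i) = d" "(\<Sum>i\<in>UNIV. Poly_Mapping.lookup a i) = d"
      using assms ab unfolding homogeneous_poly_def by auto
    then have "b = 0"
      unfolding ab(1) by (intro poly_mapping_eqI) (simp add: lookup_add sum.distrib)
    then show False using ab(3) r0 by simp
  qed
  then show "Poly_Mapping.lookup (p * q) m = Poly_Mapping.lookup (cst (Poly_Mapping.lookup q 0) * p) m"
    unfolding eq[symmetric] by (simp add: lookup_minus)
qed


section \<open>The Moore determinant and its linear factors\<close>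

text \<open>Over a field, these represent the points of projective space: each nonzero vector is
  scaled so that its last nonzero coordinate is \<open>1\<close>.\<close>

definition monic_vectors :: "('n::linorder \<Rightarrow> 'a::zero_neq_one) set" where
  "monic_vectors = {v. \<exists>m. v m = 1 \<and> (\<forall>i>m. v i = 0)}"

lemma monic_vectors_proportional:
  fixes v v' :: "'n::linorder \<Rightarrow> 'a::idom"
  assumes "v \<in> monic_vectors" "v' \<in> monic_vectors" "\<And>i. v' i = c * v i"
  shows "v' = v"
proof -
  obtain m m' where m: "v m = 1" "\<forall>i>m. v i = 0" and m': "v' m' = 1" "\<forall>i>m'. v' i = 0"
    using assms(1,2) by (auto simp: monic_vectors_def)
  have "c \<noteq> 0" using assms(3)[of m'] m' by auto
  then have "m = m'"
    using m m' assms(3)[of m] assms(3)[of m'] by (cases m m' rule: linorder_cases) auto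
  then have "c = 1" using m m' assms(3)[of m] by simp
  then show ?thesis using assms(3) by auto
qed

lemma sum_card_less:
  fixes f :: "nat \<Rightarrow> 'b::comm_monoid_add"
  shows "(\<Sum>m\<in>UNIV. f (card {i :: 'n::{finite,linorder}. i < m})) = (\<Sum>j<CARD('n). f j)"
proof -
  let ?r = "\<lambda>m. card {i :: 'n. i < m}"
  have less: "?r m < ?r m'" if "m < m'" for m m'
    using that by (intro psubset_card_mono) auto
  have inj: "inj ?r"
  proof (rule injI)
    fix m m' assume "?r m = ?r m'"
    then show "m = m'" using less[of m m'] less[of m' m] by (cases m m' rule: linorder_cases) simp_all
  qed
  have "?r m < CARD('n)" for m
    by (intro psubset_card_mono) auto
  then have "range ?r = {..<CARD('n)}"
    using inj by (intro card_subset_eq) (auto simp: card_image)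
  then show ?thesis using sum.reindex[OF inj, of f] by simp
qed

text \<open>If the last nonzero coordinate is at \<open>m\<close>, exactly the coordinates below
  \<open>m\<close> are free. The total is the degree of the Moore determinant, which makes the
  comparison in \<open>top_contraction_dvd\<close> possible.\<close>

lemma card_monic_vectors:
  "card (monic_vectors :: ('n::{finite,linorder} \<Rightarrow> 'a::{zero_neq_one,finite}) set) = (\<Sum>j<CARD('n). CARD('a) ^ j)"
proof -
  define B :: "'n \<Rightarrow> 'n \<Rightarrow> 'a set"
    where "B m i = (if i < m then UNIV else if i = m then {1} else {0})" for m i
  have mem: "v \<in> Pi\<^sub>E UNIV (B m) \<longleftrightarrow> v m = 1 \<and> (\<forall>i>m. v i = 0)" for v m
    by (auto simp: PiE_UNIV_domain B_def Pi_iff split: if_splits)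
  have "monic_vectors = (\<Union>m\<in>UNIV. Pi\<^sub>E UNIV (B m))"
    by (auto simp: monic_vectors_def mem)
  moreover have "card (\<Union>m\<in>UNIV. Pi\<^sub>E UNIV (B m)) = (\<Sum>m\<in>UNIV. card (Pi\<^sub>E UNIV (B m)))"
  proof (rule card_UN_disjoint)
    show "\<forall>m\<in>UNIV. \<forall>m'\<in>UNIV. m \<noteq> m' \<longrightarrow> Pi\<^sub>E UNIV (B m) \<inter> Pi\<^sub>E UNIV (B m') = {}"
    proof (intro ballI impI, rule equals0I, elim IntE)
      fix m m' v assume "m \<noteq> m'" "v \<in> Pi\<^sub>E UNIV (B m)" "v \<in> Pi\<^sub>E UNIV (B m')"
      then show False unfolding mem by (cases m m' rule: linorder_cases) auto
    qed
  qed auto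
  moreover have "card (Pi\<^sub>E UNIV (B m)) = CARD('a) ^ card {i. i < m}" for m
  proof -
    have "card (Pi\<^sub>E UNIV (B m)) = (\<Prod>i\<in>UNIV. if i \<in> {i. i < m} then CARD('a) else 1)"
      by (subst card_PiE) (auto simp: B_def intro!: prod.cong)
    then show ?thesis by (simp only: prod.inter_restrict[symmetric] finite) simp
  qed
  ultimately show ?thesis by (simp add: sum_card_less[of "\<lambda>j. CARD('a) ^ j"])
qed

lemma linear_form_dvd_prodD:
  fixes v :: "'n::{finite,linorder} \<Rightarrow> 'a::field"
  assumes "v m = 1" "linear_form v dvd prod f A"
  shows "\<exists>i\<in>A. linear_form v dvd f i"
  using assms(2)
proof (induction A rule: infinite_finite_induct)
  case (insert i A)
  then show ?case using linear_form_dvd_multD[of v m "f i" "prod f A"] assms(1) by auto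
qed (use assms(1) in \<open>auto simp: linear_form_dvd_iff[of v m] eliminate_def mpsubst_one\<close>)

lemma linear_form_dvd_linear_form:
  fixes v v' :: "'n::{finite,linorder} \<Rightarrow> 'a::field"
  assumes "v \<in> monic_vectors" "v' \<in> monic_vectors" "linear_form v dvd linear_form v'"
  shows "v' = v"
proof -
  obtain s where s: "linear_form v' = linear_form v * s" using assms(3) by auto
  have "homogeneous_poly 1 (linear_form v * s)"
    unfolding s[symmetric] by (rule homogeneous_poly_linear_form)
  from homogeneous_poly_eq_cst_mult[OF homogeneous_poly_linear_form this]
  have "linear_form v' = cst (Poly_Mapping.lookup s 0) * linear_form v"
    unfolding s .
  then have "v' i = Poly_Mapping.lookup s 0 * v i" for i
    by (metis lookup_linear_form lookup_cst_mult)
  then show ?thesis by (rule monic_vectors_proportional[OF assms(1,2)])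
qed

text \<open>Distinct monic linear forms are primes that do not divide one another, so each new one
  has to divide the cofactor left by the previous ones.\<close>

lemma prod_linear_form_dvd:
  fixes R :: "('n::{finite,linorder} \<Rightarrow> 'a::field) set"
  assumes "finite R" "R \<subseteq> monic_vectors" "\<And>v. v \<in> R \<Longrightarrow> linear_form v dvd p"
  shows "prod linear_form R dvd p"
  using assms
proof (induction R rule: finite_induct)
  case (insert v R)
  then obtain s where s: "p = prod linear_form R * s" by auto
  obtain m where m: "v m = 1" using insert.prems(1) by (auto simp: monic_vectors_def)
  have "\<not> linear_form v dvd prod linear_form R"
    using linear_form_dvd_prodD[of v m, OF m] linear_form_dvd_linear_form[of v] insert.prems(1) insert.hyps(2)
    by blast
  then have "linear_form v dvd s"
    using linear_form_dvd_multD[of v m "prod linear_form R" s] m insert.prems(2)[of v] s by auto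
  then show ?case using insert.hyps unfolding s by (simp add: mult.commute mult_dvd_mono)
qed simp

section \<open>The Moore determinant\<close>

definition frobenius_vars :: "nat \<Rightarrow> 'n \<Rightarrow> ('a::{field,finite}, 'n) mpoly" where
  "frobenius_vars j i = var i ^ (CARD('a) ^ j)"

lemma sum_frobenius_vars:
  fixes v :: "'n::{finite,linorder} \<Rightarrow> 'a::{field,finite}"
  assumes "prime p" "CARD('a) = p ^ k"
  shows "(\<Sum>i\<in>UNIV. cst (v i) * frobenius_vars j i) = linear_form v ^ (CARD('a) ^ j)"
  by (simp add: frobenius_vars_def linear_form_power_CARD[OF assms])

text \<open>Weighting the cofactor identities for column \<open>m\<close> with \<open>v i\<close>
  and adding them turns the determinant into a combination of the powers
  \<open>linear_form v ^ (CARD('a) ^ j)\<close>, since these powers are additive.\<close>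

lemma linear_form_dvd_top_contraction:
  fixes v :: "'n::{finite,linorder} \<Rightarrow> 'a::{field,finite}"
  assumes "prime p" "CARD('a) = p ^ k" "v m = 1"
  shows "linear_form v dvd top_contraction frobenius_vars"
proof -
  obtain u where u: "\<And>i k. (\<Sum>j<CARD('n). u j k * frobenius_vars j i) =
      (if i = k then top_contraction frobenius_vars else 0 :: ('a, 'n) mpoly)"
    using ex_cofactors[of frobenius_vars] by blast
  have "top_contraction frobenius_vars =
      (\<Sum>i\<in>UNIV. if i = m then cst (v i) * top_contraction frobenius_vars else 0)"
    by (simp add: assms(3))
  also have "\<dots> = (\<Sum>i\<in>UNIV. cst (v i) * (\<Sum>j<CARD('n). u j m * frobenius_vars j i))"
    by (rule sum.cong) (auto simp: u)
  also have "\<dots> = (\<Sum>j<CARD('n). u j m * linear_form v ^ (CARD('a) ^ j))"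
    unfolding sum_frobenius_vars[OF assms(1,2), symmetric] sum_distrib_left
    by (subst sum.swap) (simp add: mult_ac)
  finally show ?thesis by (simp add: dvd_sum)
qed

lemma homogeneous_contractions:
  assumes "\<And>S. homogeneous_poly d (ecoeff f S)"
  shows "homogeneous_poly (d + (\<Sum>j\<leftarrow>js. CARD('a) ^ j))
    (ecoeff (contractions (frobenius_vars :: _ \<Rightarrow> _ \<Rightarrow> ('a::{field,finite}, 'n::{finite,linorder}) mpoly) js f) S)"
proof (induction js arbitrary: S)
  case (Cons j js)
  have var: "homogeneous_poly (CARD('a) ^ j) (frobenius_vars j s :: ('a, 'n) mpoly)" for s
    using homogeneous_poly_power[OF homogeneous_poly_var] by (simp add: frobenius_vars_def)
  show ?case
    unfolding contractions_simps ecoeff_contraction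
    by (intro homogeneous_poly_sum)
      (use homogeneous_poly_mult[OF homogeneous_poly_minus_one_power_mult[OF var] Cons] in
        \<open>simp add: add_ac\<close>)
qed (simp add: assms)

lemma homogeneous_top_contraction:
  "homogeneous_poly (\<Sum>j<CARD('n). CARD('a) ^ j)
    (top_contraction frobenius_vars :: ('a::{field,finite}, 'n::{finite,linorder}) mpoly)"
proof -
  have "homogeneous_poly 0 (ecoeff (dxs UNIV) S :: ('a, 'n) mpoly)" for S
    by (simp add: ecoeff_dxs homogeneous_poly_0 homogeneous_poly_1)
  from homogeneous_contractions[OF this, of "[0..<CARD('n)]" "{}"] show ?thesis
    by (simp add: top_contraction_def sum_list_distinct_conv_sum_set atLeast0LessThan)
qed

text \<open>By induction on \<open>d\<close>, the first \<open>d\<close> contractions produce a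
  nonzero constant part from some form. If no product \<open>dx i * \<eta>\<close> worked for
  \<open>d + 1\<close>, a nonzero polynomial would have too many roots.\<close>

lemma top_contraction_neq_0:
  assumes "prime p" "CARD('a) = p ^ k"
  shows "top_contraction frobenius_vars \<noteq> (0 :: ('a::{field,finite}, 'n::{finite,linorder}) mpoly)"
proof -
  let ?w = "frobenius_vars :: _ \<Rightarrow> _ \<Rightarrow> ('a, 'n) mpoly"
  have q: "CARD('a) > 1"
    using card_mono[of UNIV "{0, 1 :: 'a}"] by simp
  have "\<exists>\<eta> :: ('a, 'n) poly_ext. ecoeff (contractions ?w [0..<d] \<eta>) {} \<noteq> 0" if "d \<le> CARD('n)" for d
    using that
  proof (induction d)
    case 0
    show ?case by (rule exI[of _ "dxs {}"]) (simp add: ecoeff_dxs)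
  next
    case (Suc d)
    then obtain \<eta> :: "('a, 'n) poly_ext" where \<eta>: "ecoeff (contractions ?w [0..<d] \<eta>) {} \<noteq> 0" by auto
    define c where "c = ecoeff (contractions ?w [0..<d] \<eta>) {}"
    obtain \<theta> where \<theta>: "\<And>i. contractions ?w [0..<d] (dx i * contraction (?w d) \<eta>) =
      (\<Sum>j\<in>set [0..<d]. escale (?w j i) (\<theta> j)) +
      escale ((- 1) ^ length [0..<d]) (dx i * contractions ?w [0..<d] (contraction (?w d) \<eta>))"
      using contractions_dx_mult by blast
    \<comment> \<open>\<open>F\<close> is linear over the field, so its vanishing at all variables would give it the \<open>q^n\<close> linear
      forms as roots, although its degree is at most \<open>q^d\<close>.\<close>
    define F where "F = monom c (CARD('a) ^ d) - (\<Sum>j<d. monom (ecoeff (\<theta> j) {}) (CARD('a) ^ j))"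
    have poly_F: "poly F y = c * y ^ (CARD('a) ^ d) - (\<Sum>j<d. ecoeff (\<theta> j) {} * y ^ (CARD('a) ^ j))" for y
      by (simp add: F_def poly_monom poly_sum)
    \<comment> \<open>The index \<open>d\<close> comes last in the list and is contracted first. Its
      Leibniz rule gives the leading term and a product with \<open>dx i\<close>; of the latter only
      the \<open>\<theta> j\<close> terms have a constant part.\<close>
    have F_var: "poly F (var i) = ecoeff (contractions ?w [0..<Suc d] (dx i * \<eta>)) {}" for i
      by (simp add: poly_F contraction_dx_mult contractions_diff contractions_escale \<theta>
          ecoeff_dx_mult_empty c_def frobenius_vars_def atLeast0LessThan mult.commute)
    have "Polynomial.coeff F (CARD('a) ^ d) = c"
      using q by (auto simp: F_def coeff_sum intro!: sum.neutral)
    then have "F \<noteq> 0" using \<eta> c_def by auto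
    have "Polynomial.degree F \<le> CARD('a) ^ d"
      unfolding F_def
      by (intro degree_diff_le degree_monom_le degree_sum_le finite_lessThan)
        (auto intro!: order.trans[OF degree_monom_le] power_increasing)
    show ?case
    proof (rule ccontr)
      assume "\<not> ?thesis"
      then have F0: "poly F (var i) = 0" for i by (auto simp: F_var)
      have "poly F (linear_form v) = (\<Sum>i\<in>UNIV. cst (v i) * poly F (var i))" for v
        unfolding poly_F linear_form_power_CARD[OF assms] right_diff_distrib sum_subtractf
          sum_distrib_left
        by (subst (2) sum.swap) (simp add: mult_ac)
      then have "range linear_form \<subseteq> {y. poly F y = 0}" by (auto simp: F0)
      then have "card (range (linear_form :: ('n \<Rightarrow> 'a) \<Rightarrow> _)) \<le> card {y. poly F y = 0}"
        by (rule card_mono[OF poly_roots_finite[OF \<open>F \<noteq> 0\<close>]])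
      also have "\<dots> \<le> Polynomial.degree F" by (rule card_poly_roots_bound[OF \<open>F \<noteq> 0\<close>])
      also note \<open>Polynomial.degree F \<le> CARD('a) ^ d\<close>
      also have "CARD('a) ^ d < CARD('a) ^ CARD('n)" using Suc.prems q by (intro power_strict_increasing) auto
      also have "\<dots> = card (range (linear_form :: ('n \<Rightarrow> 'a) \<Rightarrow> _))"
        by (subst card_image) (auto simp: inj_on_def linear_form_eq_iff card_fun)
      finally show False by simp
    qed
  qed
  then obtain \<eta> :: "('a, 'n) poly_ext" where \<eta>: "ecoeff (contractions ?w [0..<CARD('n)] \<eta>) {} \<noteq> 0"
    by blast
  \<comment> \<open>After \<open>CARD('n)\<close> contractions only the top coefficient of
    \<open>\<eta>\<close> can contribute, so the determinant itself is nonzero.\<close>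
  have "ecoeff (contractions ?w [0..<CARD('n)] \<eta>) {} =
      (\<Sum>S\<in>UNIV. ecoeff \<eta> S * ecoeff (contractions ?w [0..<CARD('n)] (dxs S)) {})"
    by (subst exterior_expansion[of \<eta>]) (simp add: contractions_sum contractions_escale)
  also have "\<dots> = (\<Sum>S\<in>UNIV. if S = UNIV then ecoeff \<eta> S * top_contraction ?w else 0)"
  proof (rule sum.cong)
    fix S :: "'n set"
    have "contractions ?w [0..<CARD('n)] (dxs S) = 0" if "S \<noteq> UNIV"
      by (rule contractions_eq_0_if_degree[OF pure_form_dxs]) (use that psubset_card_mono[of UNIV S] in auto)
    then show "ecoeff \<eta> S * ecoeff (contractions ?w [0..<CARD('n)] (dxs S)) {} =
        (if S = UNIV then ecoeff \<eta> S * top_contraction ?w else 0)"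
      by (auto simp: top_contraction_def)
  qed simp
  finally show ?thesis using \<eta> by auto
qed

text \<open>The product of the monic linear forms divides the determinant and has the same degree,
  so the cofactor is a constant, nonzero because the determinant is.\<close>

lemma top_contraction_dvd:
  fixes P :: "('a::{field,finite}, 'n::{finite,linorder}) mpoly"
  assumes "prime p" "CARD('a) = p ^ k"
    and dvd: "\<And>v m. v m = 1 \<Longrightarrow> linear_form v dvd P"
  shows "top_contraction frobenius_vars dvd P"
proof -
  let ?M = "prod linear_form (monic_vectors :: ('n \<Rightarrow> 'a) set)"
  have "?M dvd top_contraction frobenius_vars"
    by (rule prod_linear_form_dvd) (auto simp: monic_vectors_def intro: linear_form_dvd_top_contraction[OF assms(1,2)])
  then obtain s where s: "top_contraction frobenius_vars = ?M * s" by auto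
  have "homogeneous_poly (\<Sum>v\<in>(monic_vectors :: ('n \<Rightarrow> 'a) set). 1) ?M"
    by (rule homogeneous_poly_prod) (rule homogeneous_poly_linear_form)
  then have "homogeneous_poly (\<Sum>j<CARD('n). CARD('a) ^ j) ?M"
    by (simp add: card_monic_vectors)
  moreover have "homogeneous_poly (\<Sum>j<CARD('n). CARD('a) ^ j) (?M * s)"
    unfolding s[symmetric] by (rule homogeneous_top_contraction)
  ultimately have eq: "top_contraction frobenius_vars = cst (Poly_Mapping.lookup s 0) * ?M"
    unfolding s by (rule homogeneous_poly_eq_cst_mult)
  then have "Poly_Mapping.lookup s 0 \<noteq> 0"
    using top_contraction_neq_0[OF assms(1,2), where 'n = 'n] by auto
  then have "cst (inverse (Poly_Mapping.lookup s 0)) * top_contraction frobenius_vars = ?M"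
    unfolding eq by (simp flip: cst_simps(4) mult.assoc)
  then have "top_contraction frobenius_vars dvd ?M" by (metis dvd_triv_right)
  also have "?M dvd P"
    by (rule prod_linear_form_dvd) (auto simp: monic_vectors_def intro: dvd)
  finally show ?thesis .
qed


section \<open>The group action and transvections\<close>

lemma act_add: "act g (f + h) = act g f + act g h"
  and act_mult: "act g (f * h) = act g f * act g h"
  and act_zero: "act g 0 = 0"
  by (simp_all add: act_eq_act_formula act_formula_add act_formula_mult act_formula_zero)

lemma act_escale_dxs: "act g (escale p (dxs S)) = escale (act_poly g p) (ordered_prod (act_dx g) S)"
  by (simp add: act_eq_act_formula act_formula_escale_dxs)

lemma act_poly_emb: "act g (poly_emb p) = poly_emb (act_poly g p)"
  using act_escale_dxs[of g p "{}"] by (simp add: poly_emb_def dxs_empty)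

lemma act_one: "act g 1 = 1"
  using act_poly_emb[of g 1] by (simp add: act_poly_simps)

lemma act_escale: "act g (escale p f) = escale (act_poly g p) (act g f)"
  by (simp add: escale_eq_poly_emb_mult act_mult act_poly_emb)

lemma act_dx: "act g (dx i) = act_dx g i"
  using act_escale_dxs[of g 1 "{i}"] by (simp add: dx_def act_poly_simps ordered_prod_def)

lemma act_diff: "act g (f - h) = act g f - act g h"
  by (metis act_add add_diff_cancel diff_add_cancel)

lemma act_poly_diff: "act_poly g (p - r) = act_poly g p - act_poly g r"
  by (metis act_poly_simps(1) add_diff_cancel diff_add_cancel)

lemma poly_emb_eq_iff: "poly_emb p = poly_emb r \<longleftrightarrow> p = r"
  unfolding poly_emb_def dxs_empty[symmetric]
  by (metis ecoeff_dxs ecoeff_escale mult.right_neutral)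

lemma poly_invariants_iff: "p \<in> poly_invariants G \<longleftrightarrow> (\<forall>g\<in>G. act_poly g p = p)"
  by (simp add: poly_invariants_def act_poly_emb poly_emb_eq_iff)

lemma act_dx_mult: "act_dx g i * f = (\<Sum>j\<in>UNIV. escale (cst (matrix_inv g $ i $ j)) (dx j * f))"
  by (simp add: act_dx_def sum_distrib_right escale_mult_left)

lemma ecoeff_act_empty: "ecoeff (act g f) {} = act_poly g (ecoeff f {})"
  by (induction f rule: exterior_induct)
    (simp_all add: act_one act_add act_escale act_mult act_dx act_dx_mult ecoeff_one act_poly_simps
      ecoeff_dx_mult_empty)

lemma ecoeff_act_singleton:
  "ecoeff (act g f) {k} = (\<Sum>r\<in>UNIV. act_poly g (ecoeff f {r}) * cst (matrix_inv g $ r $ k))"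
proof (induction f rule: exterior_induct)
  case (dx_mult i f)
  have "(\<Sum>r\<in>UNIV. act_poly g (ecoeff (dx i * f) {r}) * cst (matrix_inv g $ r $ k)) =
      (\<Sum>r\<in>UNIV. if r = i then act_poly g (ecoeff f {}) * cst (matrix_inv g $ i $ k) else 0)"
    by (rule sum.cong) (auto simp: ecoeff_dx_mult_singleton act_poly_simps)
  then show ?case
    by (simp add: act_mult act_dx act_dx_mult ecoeff_dx_mult_singleton ecoeff_act_empty if_distrib
        mult.commute cong: if_cong)
qed (simp_all add: act_one act_add act_escale ecoeff_one act_poly_simps sum.distrib
    sum_distrib_left algebra_simps)

section \<open>Equivariance of the contractions\<close>

lemma act_poly_frobenius_vars:
  fixes g :: "'a::{field,finite}^'n::{finite,linorder}^'n::{finite,linorder}"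
  assumes "prime p" "CARD('a) = p ^ k"
  shows "act_poly g (frobenius_vars j i) = (\<Sum>l\<in>UNIV. cst (matrix_inv g $ i $ l) * frobenius_vars j l)"
proof -
  have "act_poly g (r ^ d) = act_poly g r ^ d" for r and d :: nat
    by (induction d) (simp_all add: act_poly_simps)
  then show ?thesis
    using linear_form_power_CARD[OF assms, of "\<lambda>l. matrix_inv g $ i $ l" j]
    by (simp add: frobenius_vars_def act_poly_simps linear_form_def)
qed

text \<open>The powers \<open>frobenius_vars j i\<close> and the generators \<open>dx i\<close> are
  transformed by the same matrix, since Frobenius powers are additive and fix the constants.\<close>

lemma contraction_act:
  fixes g :: "'a::{field,finite}^'n::{finite,linorder}^'n::{finite,linorder}"
  assumes "prime p" "CARD('a) = p ^ k"
  shows "contraction (frobenius_vars j) (act g f) = act g (contraction (frobenius_vars j) f)"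
proof (induction f rule: exterior_induct)
  case (dx_mult i f)
  have "contraction (frobenius_vars j) (act_dx g i * act g f) =
      escale (act_poly g (frobenius_vars j i)) (act g f) - act_dx g i * contraction (frobenius_vars j) (act g f)"
    by (simp add: act_dx_mult contraction_sum contraction_escale contraction_dx_mult
        escale.scale_right_diff_distrib sum_subtractf act_poly_frobenius_vars[OF assms]
        escale.scale_sum_left)
  then show ?case using dx_mult by (simp add: act_mult act_dx contraction_dx_mult act_diff act_escale)
qed (simp_all add: act_one contraction_one act_zero act_add contraction_add act_escale contraction_escale)

lemma contractions_act:
  fixes g :: "'a::{field,finite}^'n::{finite,linorder}^'n::{finite,linorder}"
  assumes "prime p" "CARD('a) = p ^ k"
  shows "contractions frobenius_vars js (act g f) = act g (contractions frobenius_vars js f)"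
  by (induction js) (simp_all add: contraction_act[OF assms])

lemma milnor_set_eq_contraction_set:
  "(milnor_set I :: ('a::{field,finite}, 'n::{finite,linorder}) poly_ext \<Rightarrow> _) = contraction_set frobenius_vars I"
proof -
  have "milnor = (\<lambda>j. contraction (frobenius_vars j) :: ('a, 'n) poly_ext \<Rightarrow> _)"
    by (simp add: fun_eq_iff milnor_eq_contraction frobenius_vars_def[abs_def])
  then show ?thesis by (simp add: milnor_set_def contraction_set_def contractions_def)
qed

lemma dx_top_eq: "dx_top = dxs UNIV"
  by (simp add: dx_top_def dxs_eq_ordered_prod)

lemma act_dx_top:
  fixes g :: "'a::field^'n::{finite,linorder}^'n::{finite,linorder}"
  assumes "g \<in> SL"
  shows "act g dx_top = dx_top"
proof -
  have "invertible g" using assms by (simp add: SL_def invertible_det_nz)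
  then have "g ** matrix_inv g = mat 1"
    unfolding invertible_def matrix_inv_def by (metis (mono_tags, lifting) someI_ex)
  then have "det g * det (matrix_inv g) = 1" by (metis det_I det_mul)
  then have det: "det (matrix_inv g) = 1" using assms by (simp add: SL_def)
  \<comment> \<open>The entries are viewed as constant polynomials, because the exterior algebra has
    polynomial coefficients.\<close>
  let ?A = "\<chi> i j. (cst (matrix_inv g $ i $ j) :: ('a, 'n) mpoly)"
  have "det ?A = cst (det (matrix_inv g))"
    by (simp add: det_def cst_sum cst_prod of_int_eq_cst)
  moreover have "ordered_prod (act_dx g) UNIV = escale (det ?A) (dxs UNIV)"
    unfolding ordered_prod_linear_comb_dx_UNIV[symmetric]
    by (rule ordered_prod_cong) (simp add: act_dx_def)
  ultimately show ?thesis
    using act_escale_dxs[of g 1 UNIV] by (simp add: det dx_top_eq act_poly_simps)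
qed

section \<open>Transvections\<close>

definition transvection :: "('n \<Rightarrow> 'a) \<Rightarrow> ('n \<Rightarrow> 'a) \<Rightarrow> 'a::comm_ring_1^'n^'n" where
  "transvection v b = (\<chi> i j. (if i = j then 1 else 0) + b i * v j)"

text \<open>The product of the two rank-one parts contains the scalar
  \<open>\<Sum>i\<in>UNIV. v i * b' i\<close>, which vanishes.\<close>

lemma transvection_mult:
  fixes v :: "'n::finite \<Rightarrow> 'a::comm_ring_1"
  assumes "(\<Sum>i\<in>UNIV. v i * b' i) = 0"
  shows "transvection v b ** transvection v b' = transvection v (\<lambda>i. b i + b' i)"
proof -
  have "(\<Sum>k\<in>UNIV. ((if i = k then 1 else 0) + b i * v k) * ((if k = j then 1 else 0) + b' k * v j)) =
      (if i = j then 1 else 0) + (b i + b' i) * v j" for i j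
  proof -
    have "(\<Sum>k\<in>UNIV. ((if i = k then 1 else 0) + b i * v k) * ((if k = j then 1 else 0) + b' k * v j)) =
        (\<Sum>k\<in>UNIV. (if i = k then (if k = j then 1 else 0) else 0) + (if i = k then b' k * v j else 0) +
          (if k = j then b i * v k else 0) + b i * v j * (v k * b' k))"
      by (rule sum.cong) (auto simp: algebra_simps)
    then show ?thesis
      by (simp add: sum.distrib assms distrib_right flip: sum_distrib_left)
  qed
  then show ?thesis by (simp add: transvection_def matrix_matrix_mult_def)
qed

lemma transvection_0: "transvection v (\<lambda>i. 0) = mat 1"
  by (simp add: transvection_def mat_def)

text \<open>The \<open>q\<close>-th power of the transvection is the identity, while \<open>det\<^bsup>q\<^esup> = det\<close> in the field.\<close>

lemma det_transvection:
  fixes v :: "'n::finite \<Rightarrow> 'a::{field,finite}"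
  assumes "(\<Sum>i\<in>UNIV. v i * b i) = 0"
  shows "det (transvection v b) = 1"
proof -
  have "det (transvection v (\<lambda>i. of_nat d * b i)) = det (transvection v b) ^ d" for d
  proof (induction d)
    case (Suc d)
    have "transvection v (\<lambda>i. of_nat (Suc d) * b i) = transvection v (\<lambda>i. of_nat d * b i) ** transvection v b"
      by (subst transvection_mult[OF assms(1)]) (simp add: algebra_simps)
    then show ?case using Suc by (simp add: det_mul)
  qed (simp add: transvection_0)
  from this[of "CARD('a)"] show ?thesis
    by (simp add: of_nat_CARD_eq_0 transvection_0 finite_field_power_CARD)
qed

text \<open>The action is defined through \<open>matrix_inv g\<close>, so the transvection is
  provided as an inverse; \<open>g\<close> itself is the one for \<open>- b\<close>.\<close>

lemma ex_SL_transvection: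
  fixes v :: "'n::finite \<Rightarrow> 'a::{field,finite}"
  assumes "(\<Sum>i\<in>UNIV. v i * b i) = 0"
  shows "\<exists>g\<in>SL. matrix_inv g = transvection v b"
proof -
  let ?g = "transvection v (\<lambda>i. - b i)"
  have neg: "(\<Sum>i\<in>UNIV. v i * - b i) = 0" using assms(1) by (simp add: sum_negf)
  have inv: "?g ** transvection v b = mat 1" "transvection v b ** ?g = mat 1"
    using transvection_mult[OF assms(1), of "\<lambda>i. - b i"] transvection_mult[OF neg, of b]
    by (simp_all add: transvection_0)
  then have "?g ** matrix_inv ?g = mat 1"
    unfolding matrix_inv_def by (metis (mono_tags, lifting) someI_ex)
  then have "matrix_inv ?g = transvection v b"
    by (metis inv(2) matrix_mul_assoc matrix_mul_lid matrix_mul_rid)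
  moreover have "?g \<in> SL" by (simp add: SL_def det_transvection[OF neg])
  ultimately show ?thesis by blast
qed

text \<open>The transvection \<open>x\<^sub>r \<mapsto> x\<^sub>r + b\<^sub>r l\<close>, where \<open>l\<close> is the linear form of \<open>v\<close> and
  \<open>b = e\<^sub>i - v\<^sub>i e\<^sub>m\<close>, is the identity modulo \<open>l\<close> on \<open>P\<^sub>n\<close>; comparing the coefficients of
  \<open>dx\<^sub>m\<close> in \<open>g h = h\<close> gives the claim.\<close>

lemma linear_form_dvd_coeff_diff:
  fixes v :: "'n::{finite,linorder} \<Rightarrow> 'a::{field,finite}"
  assumes h: "h \<in> invariants SL" and v: "v m = 1"
  shows "linear_form v dvd ecoeff h {i} - cst (v i) * ecoeff h {m}"
proof (cases "i = m")
  case False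
  define b where "b r = (if r = i then 1 else 0) - (if r = m then v i else 0)" for r
  have "(\<Sum>r\<in>UNIV. v r * b r) = (\<Sum>r\<in>UNIV. (if r = i then v i else 0) - (if r = m then v i else 0))"
    by (rule sum.cong) (auto simp: b_def v)
  then have "(\<Sum>r\<in>UNIV. v r * b r) = 0" by (simp add: sum_subtractf)
  then obtain g where g: "g \<in> SL" "matrix_inv g = transvection v b"
    using ex_SL_transvection by blast
  define \<delta> where "\<delta> r = act_poly g (ecoeff h {r}) - ecoeff h {r}" for r
  have \<delta>: "linear_form v dvd \<delta> r" for r
  proof -
    have "linear_form v dvd act_poly g p - mpsubst var p" for p
      unfolding act_poly_def
    proof (rule dvd_mpsubst_diff)
      fix i
      have "(\<Sum>j\<in>UNIV. cst (matrix_inv g $ i $ j) * var j) =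
          (\<Sum>j\<in>UNIV. (if i = j then var j else 0) + cst (b i) * (cst (v j) * var j))"
        by (rule sum.cong) (auto simp: g(2) transvection_def algebra_simps)
      then have "(\<Sum>j\<in>UNIV. cst (matrix_inv g $ i $ j) * var j) = var i + cst (b i) * linear_form v"
        by (simp add: sum.distrib linear_form_def sum_distrib_left)
      then show "linear_form v dvd (\<Sum>j\<in>UNIV. cst (matrix_inv g $ i $ j) * var j) - var i" by simp
    qed
    then show ?thesis by (simp add: \<delta>_def mpsubst_eq_var)
  qed
  have "ecoeff h {m} = ecoeff (act g h) {m}" using h g(1) by (simp add: invariants_def)
  \<comment> \<open>Column \<open>m\<close> of the transvection has nonzero entries at most in rows
    \<open>m\<close> and \<open>i\<close>: \<open>1 - v i\<close> and \<open>1\<close>.\<close>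
  also have "\<dots> = (\<Sum>r\<in>UNIV. (if r = m then ecoeff h {r} + \<delta> r else 0) + ((if r = i then ecoeff h {r} + \<delta> r else 0) -
      (if r = m then cst (v i) * (ecoeff h {r} + \<delta> r) else 0)))"
    unfolding ecoeff_act_singleton
    by (rule sum.cong) (use False in \<open>auto simp: g(2) transvection_def v b_def \<delta>_def cst_diff cst_uminus algebra_simps\<close>)
  finally have "ecoeff h {i} - cst (v i) * ecoeff h {m} = cst (v i) * \<delta> m - \<delta> m - \<delta> i"
    by (simp add: sum.distrib sum_subtractf algebra_simps)
  then show ?thesis using \<delta> by (simp add: dvd_diff)
qed (simp add: v)

lemma top_contraction_dvd_contraction:
  fixes h :: "('a::{field,finite}, 'n::{finite,linorder}) poly_ext"
  assumes "prime p" "CARD('a) = p ^ k" and h: "h \<in> invariants SL"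
  shows "top_contraction frobenius_vars dvd ecoeff (contraction (frobenius_vars j) h) {}"
proof (rule top_contraction_dvd[OF assms(1,2)])
  fix v :: "'n \<Rightarrow> 'a" and m assume v: "v m = 1"
  have "ecoeff (contraction (frobenius_vars j) h) {} = (\<Sum>s\<in>UNIV. frobenius_vars j s * ecoeff h {s})"
    by (simp add: ecoeff_contraction below_def)
  \<comment> \<open>Each \<open>ecoeff h {s}\<close> is split into its deviation from
    \<open>cst (v s) * ecoeff h {m}\<close> and this multiple; the multiples add up to a power of
    the linear form.\<close>
  also have "\<dots> = (\<Sum>s\<in>UNIV. frobenius_vars j s * (ecoeff h {s} - cst (v s) * ecoeff h {m})) +
      linear_form v ^ (CARD('a) ^ j) * ecoeff h {m}"
    by (simp add: algebra_simps sum.distrib sum_subtractf sum_distrib_left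
        flip: sum_frobenius_vars[OF assms(1,2)])
  also have "linear_form v dvd \<dots>"
    by (intro dvd_add dvd_sum dvd_mult dvd_mult2)
      (simp_all add: linear_form_dvd_coeff_diff[OF h, of v m, OF v])
  finally show "linear_form v dvd ecoeff (contraction (frobenius_vars j) h) {}" .
qed


section \<open>The basis of the invariants\<close>

lemma contractions_invariants:
  fixes f :: "('a::{field,finite}, 'n::{finite,linorder}) poly_ext"
  assumes "prime p" "CARD('a) = p ^ k" and f: "f \<in> invariants G"
  shows "contractions frobenius_vars js f \<in> invariants G"
  using f contractions_act[OF assms(1,2), where f = f] by (simp add: invariants_def) metis

lemma ecoeff_empty_invariants: "f \<in> invariants G \<Longrightarrow> ecoeff f {} \<in> poly_invariants G"
  by (metis (mono_tags, lifting) ecoeff_act_empty invariants_def mem_Collect_eq poly_invariants_iff)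

lemma dx_top_invariants: "dxs UNIV \<in> invariants SL"
  using act_dx_top by (auto simp: invariants_def dx_top_eq)

lemma top_contraction_invariants:
  assumes "prime p" "CARD('a) = p ^ k"
  shows "(top_contraction frobenius_vars :: ('a::{field,finite}, 'n::{finite,linorder}) mpoly) \<in> poly_invariants SL"
  unfolding top_contraction_def
  by (intro ecoeff_empty_invariants contractions_invariants[OF assms] dx_top_invariants)

lemma poly_invariants_quotient:
  fixes b c :: "('a::field, 'n::{finite,linorder}) mpoly"
  assumes "b * c \<in> poly_invariants G" "b \<in> poly_invariants G" "b \<noteq> 0"
  shows "c \<in> poly_invariants G"
  using assms by (simp add: poly_invariants_iff act_poly_simps)

lemma poly_invariants_sign_mult:
  "e \<in> {1, - 1} \<Longrightarrow> c \<in> poly_invariants G \<Longrightarrow> e * c \<in> poly_invariants G"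
  using act_poly_minus_one_power[of _ 1] by (auto simp: poly_invariants_iff act_poly_simps)

text \<open>The outermost contraction is split off and the others keep the form invariant, so
  divisibility for a single contraction applies. The quotient is invariant because the determinant
  is invariant and can be cancelled.\<close>

lemma contraction_set_coefficient:
  fixes f :: "('a::{field,finite}, 'n::{finite,linorder}) poly_ext"
  assumes "prime p" "CARD('a) = p ^ k" and f: "f \<in> invariants SL"
    and J: "finite J" "J \<noteq> {}"
  shows "\<exists>c\<in>poly_invariants SL. ecoeff (contraction_set frobenius_vars J f) {} = top_contraction frobenius_vars * c"
proof -
  obtain j js where js: "sorted_list_of_set J = j # js"
    using J by (cases "sorted_list_of_set J") auto
  have "contractions frobenius_vars js f \<in> invariants SL"
    by (rule contractions_invariants[OF assms(1-3)])
  from top_contraction_dvd_contraction[OF assms(1,2) this, of j] obtain c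
    where c: "ecoeff (contraction_set frobenius_vars J f) {} = top_contraction frobenius_vars * c"
    by (auto simp: contraction_set_def js)
  moreover have "ecoeff (contraction_set frobenius_vars J f) {} \<in> poly_invariants SL"
    unfolding contraction_set_def by (intro ecoeff_empty_invariants contractions_invariants[OF assms(1-3)])
  ultimately have "c \<in> poly_invariants SL"
    using top_contraction_invariants[OF assms(1,2)] top_contraction_neq_0[OF assms(1,2)]
    by (intro poly_invariants_quotient[of "top_contraction frobenius_vars" c]) auto
  then show ?thesis using c by blast
qed

text \<open>Independence is tested by functionals that vanish on all basis elements but one. A
  nonzero value there suffices, as polynomials over a field form a domain.\<close>

lemma free_module_with_basis_invariantsI:
  fixes B :: "('a::field, 'n::{finite,linorder}) poly_ext set"
  assumes "finite B" "B \<subseteq> invariants G"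
    and span: "\<And>f. f \<in> invariants G \<Longrightarrow> \<exists>c. c ` B \<subseteq> poly_invariants G \<and> f = (\<Sum>b\<in>B. escale (c b) b)"
    and dual: "\<And>b. b \<in> B \<Longrightarrow> \<exists>D. (\<forall>f h. D (f + h) = D f + D h) \<and> (\<forall>r f. D (escale r f) = r * D f) \<and>
      D b \<noteq> (0 :: ('a, 'n) mpoly) \<and> (\<forall>b'\<in>B - {b}. D b' = 0)"
  shows "free_module_with_basis escale (poly_invariants G) (invariants G) B"
  unfolding free_module_with_basis_def
proof (intro conjI ballI allI impI)
  show "module (escale :: ('a, 'n) mpoly \<Rightarrow> ('a, 'n) poly_ext \<Rightarrow> _)" by (rule escale.module_axioms)
  show "is_subring (poly_invariants G)"
    by (simp add: is_subring_def poly_invariants_iff act_poly_simps act_poly_diff)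
  show "is_submodule_over escale (poly_invariants G) (invariants G)"
    by (auto simp: is_submodule_over_def invariants_def poly_invariants_iff act_zero act_add act_escale)
  show "B \<subseteq> invariants G" by fact
  show "\<exists>F c. finite F \<and> F \<subseteq> B \<and> c ` F \<subseteq> poly_invariants G \<and> f = (\<Sum>b\<in>F. escale (c b) b)"
    if "f \<in> invariants G" for f
    using span[OF that] \<open>finite B\<close> by blast
  fix F c b
  assume F: "finite F \<and> F \<subseteq> B \<and> c ` F \<subseteq> poly_invariants G \<and> (\<Sum>b\<in>F. escale (c b) b) = 0" and b: "b \<in> F"
  then obtain D where D: "\<And>f h. D (f + h) = D f + D h" "\<And>r f. D (escale r f) = r * D f"
    "D b \<noteq> (0 :: ('a, 'n) mpoly)" "\<And>b'. b' \<in> B - {b} \<Longrightarrow> D b' = 0"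
    using dual[of b] by (metis (no_types, lifting) subsetD)
  have D0: "D 0 = 0" using D(2)[of 0 0] by simp
  have "0 = D (\<Sum>b\<in>F. escale (c b) b)" using F D0 by simp
  also have "\<dots> = (\<Sum>b\<in>F. c b * D b)"
    using conjunct1[OF F] by (induction F rule: finite_induct) (simp_all add: D0 D(1,2))
  also have "\<dots> = (\<Sum>b'\<in>F. if b' = b then c b * D b else 0)"
    by (rule sum.cong) (use conjunct1[OF conjunct2[OF F]] D(4) in auto)
  also have "\<dots> = c b * D b"
    using conjunct1[OF F] b by simp
  finally show "c b = 0" using D(3) by simp
qed

theorem theorem1p1:
  fixes p k :: nat
  assumes "prime p" and "odd p" and "k \<ge> 1" and "CARD('a::{field,finite}) = p ^ k"
  shows "free_module_with_basis escale (poly_invariants SL) (invariants SL)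
           ({1} \<union> {milnor_set I (dx_top :: ('a, 'n::{finite,linorder}) poly_ext) | I.
                     I \<subset> {0..<CARD('n)}}) \<and>
         inj_on (\<lambda>I. milnor_set I (dx_top :: ('a, 'n) poly_ext)) {I. I \<subset> {0..<CARD('n)}} \<and>
         1 \<notin> {milnor_set I (dx_top :: ('a, 'n) poly_ext) | I. I \<subset> {0..<CARD('n)}}"
proof -
  note q = assms(1,4)
  let ?N = "{0..<CARD('n)}"
  let ?P = "{I. I \<subset> ?N}"
  let ?L = "top_contraction frobenius_vars :: ('a, 'n) mpoly"
  define b where "b I = (milnor_set I dx_top :: ('a, 'n) poly_ext)" for I
  \<comment> \<open>These are the coordinate functionals: \<open>D {}\<close> belongs to
    \<open>1\<close>, and \<open>D (?N - I)\<close> to \<open>b I\<close>, up to sign and the factor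
    \<open>?L\<close>.\<close>
  define D where "D J f = ecoeff (contraction_set frobenius_vars J f) {}" for J and f :: "('a, 'n) poly_ext"
  have D_linear: "D J (f + h) = D J f + D J h" "D J (f - h) = D J f - D J h"
    "D J (escale r f) = r * D J f" "D J (sum F A) = (\<Sum>a\<in>A. D J (F a))"
    for J f h r A and F :: "nat set \<Rightarrow> ('a, 'n) poly_ext"
    by (simp_all add: D_def contraction_set_linear)
  have L: "?L \<noteq> 0" by (rule top_contraction_neq_0[OF q])
  have b_eq: "b I = contraction_set frobenius_vars I (dxs UNIV)" for I
    by (simp add: b_def milnor_set_eq_contraction_set dx_top_eq)
  have D_one: "D J 1 = (if J = {} then 1 else 0)" if "J \<subseteq> ?N" for J
    unfolding D_def using that finite_subset by (intro ecoeff_contraction_set_one) blast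
  have D_b_0: "D J (b I) = 0" if "I \<in> ?P" "J \<subseteq> ?N" "J \<noteq> ?N - I" for I J
    unfolding D_def b_eq using that by (intro ecoeff_contraction_set_top_eq_0) auto
  have "\<forall>I\<in>?P. \<exists>e\<in>{1, - 1}. D (?N - I) (b I) = e * ?L"
    unfolding D_def b_eq by (intro ballI ecoeff_contraction_set_top) auto
  then obtain \<epsilon> where \<epsilon>: "\<And>I. I \<in> ?P \<Longrightarrow> \<epsilon> I \<in> {1, - 1}" "\<And>I. I \<in> ?P \<Longrightarrow> D (?N - I) (b I) = \<epsilon> I * ?L"
    by (metis (no_types, lifting))
  have D_b: "D (?N - I) (b I) \<noteq> 0" if "I \<in> ?P" for I
    using \<epsilon>[OF that] L by auto
  have D_b_other: "D (?N - I) (b I') = 0" if "I \<in> ?P" "I' \<in> ?P" "I \<noteq> I'" for I I'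
    using that by (intro D_b_0) auto
  have inj: "inj_on b ?P"
  proof (rule inj_onI, rule ccontr)
    fix I I' assume "I \<in> ?P" "I' \<in> ?P" "b I = b I'" "I \<noteq> I'"
    then show False using D_b[of I] D_b_other[of I I'] by simp
  qed
  have D_empty_b: "D {} (b I) = 0" if "I \<in> ?P" for I
    using that by (intro D_b_0) auto
  have one: "1 \<notin> b ` ?P"
  proof
    assume "1 \<in> b ` ?P"
    then obtain I where I: "1 = b I" "I \<in> ?P" by (rule imageE)
    show False using D_empty_b[OF I(2)] D_one[of "{}"] unfolding I(1)[symmetric] by simp
  qed
  have fin: "finite ?P" by (rule finite_subset[of _ "Pow ?N"]) auto
  have basis: "{1} \<union> {milnor_set I (dx_top :: ('a, 'n) poly_ext) | I. I \<subset> ?N} = insert 1 (b ` ?P)"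
    by (auto simp: b_def)
  have "free_module_with_basis escale (poly_invariants SL) (invariants SL) (insert 1 (b ` ?P))"
  proof (rule free_module_with_basis_invariantsI)
    show "finite (insert 1 (b ` ?P))" using fin by simp
    have "b I \<in> invariants SL" for I
      unfolding b_eq contraction_set_def by (intro contractions_invariants[OF q] dx_top_invariants)
    then show "insert 1 (b ` ?P) \<subseteq> invariants SL" by (auto simp: invariants_def act_one)
  next
    fix f :: "('a, 'n) poly_ext" assume f: "f \<in> invariants SL"
    \<comment> \<open>A proper subset has a nonempty complement, so at least one contraction is
      available and \<open>?L\<close> can be divided out.\<close>
    have "\<forall>I\<in>?P. \<exists>c\<in>poly_invariants SL. D (?N - I) f = ?L * c"
      unfolding D_def by (intro ballI contraction_set_coefficient[OF q f]) auto
    then obtain c where c: "\<And>I. I \<in> ?P \<Longrightarrow> c I \<in> poly_invariants SL"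
      "\<And>I. I \<in> ?P \<Longrightarrow> D (?N - I) f = ?L * c I"
      by (metis (no_types, lifting))
    \<comment> \<open>The only possible expansion of \<open>f\<close>. The sign
      \<open>\<epsilon> I\<close> is its own inverse, so it appears as a factor.\<close>
    define h where "h = escale (D {} f) 1 + (\<Sum>I\<in>?P. escale (\<epsilon> I * c I) (b I))"
    have "D J (f - h) = 0" if J: "J \<subseteq> ?N" for J
    proof (cases "J = {}")
      case True
      then show ?thesis
        using D_one[of "{}"] by (simp add: h_def D_linear D_empty_b)
    next
      case False
      define I where "I = ?N - J"
      have I: "I \<in> ?P" "J = ?N - I" using J False by (auto simp: I_def)
      have "D J h = (\<Sum>I\<in>?P. \<epsilon> I * c I * D J (b I))"
        using D_one[OF J] False by (simp add: h_def D_linear)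
      also have "\<dots> = (\<Sum>I'\<in>?P. if I' = I then \<epsilon> I * c I * D J (b I) else 0)"
        unfolding I(2) by (rule sum.cong) (auto simp: D_b_other[OF I(1)])
      also have "\<dots> = \<epsilon> I * c I * D J (b I)"
        using I(1) fin by simp
      also have "\<dots> = D J f"
        using c(2)[OF I(1)] \<epsilon>[OF I(1)] by (auto simp: I(2))
      finally show ?thesis by (simp add: D_linear)
    qed
    then have "f - h = 0"
      by (intro eq_0_if_contraction_sets[OF L]) (simp add: D_def)
    then have fh: "f = h" by simp
    \<comment> \<open>The coefficients are re-indexed from subsets to basis elements, which is
      consistent because \<open>b\<close> is injective on \<open>?P\<close> and never takes the
      value \<open>1\<close> there.\<close>
    define d where "d x = (if x = 1 then D {} f else \<epsilon> (the_inv_into ?P b x) * c (the_inv_into ?P b x))" for x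
    have d_b: "d (b I) = \<epsilon> I * c I" if "I \<in> ?P" for I
      using one that by (auto simp: d_def the_inv_into_f_f[OF inj])
    have "(\<Sum>x\<in>insert 1 (b ` ?P). escale (d x) x) = escale (d 1) 1 + (\<Sum>I\<in>?P. escale (d (b I)) (b I))"
      using one fin by (simp add: sum.reindex[OF inj])
    also have "\<dots> = h" by (simp add: h_def d_b) (simp add: d_def)
    finally have sum: "f = (\<Sum>x\<in>insert 1 (b ` ?P). escale (d x) x)" by (simp add: fh)
    have "D {} f \<in> poly_invariants SL"
      using f by (simp add: D_def ecoeff_empty_invariants)
    moreover have "d (b I) \<in> poly_invariants SL" if "I \<in> ?P" for I
      unfolding d_b[OF that] by (rule poly_invariants_sign_mult[OF \<epsilon>(1)[OF that] c(1)[OF that]])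
    ultimately have "d ` insert 1 (b ` ?P) \<subseteq> poly_invariants SL"
      unfolding image_insert image_image by (intro insert_subsetI image_subsetI) (simp add: d_def)
    with sum show "\<exists>c. c ` insert 1 (b ` ?P) \<subseteq> poly_invariants SL \<and> f = (\<Sum>x\<in>insert 1 (b ` ?P). escale (c x) x)"
      by blast
  next
    fix x assume "x \<in> insert 1 (b ` ?P)"
    then consider "x = 1" | I where "I \<in> ?P" "x = b I" by blast
    then have "\<exists>J. D J x \<noteq> 0 \<and> (\<forall>x'\<in>insert 1 (b ` ?P) - {x}. D J x' = 0)"
    proof cases
      case 1
      then show ?thesis using D_one[of "{}"] D_empty_b by (intro exI[of _ "{}"]) auto
    next
      case 2
      then have "D (?N - I) 1 = 0" using D_one[of "?N - I"] by auto
      then show ?thesis using 2 D_b D_b_other by (intro exI[of _ "?N - I"]) auto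
    qed
    then show "\<exists>D. (\<forall>f h. D (f + h) = D f + D h) \<and> (\<forall>r f. D (escale r f) = r * D f) \<and>
      D x \<noteq> (0 :: ('a, 'n) mpoly) \<and> (\<forall>b'\<in>insert 1 (b ` ?P) - {x}. D b' = 0)"
      using D_linear by metis
  qed
  then show ?thesis
    using inj one by (simp only: basis) (auto simp: b_def[abs_def])
qed

end
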